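(* Let $\mathbb{F}_q$ be a finite field with $q$ elements, let $n>1$ and $1\le d<n$ be integers, and let $\alpha\in\mathbb{F}_{q^n}$ be a root of an irreducible polynomial $f(x)\in\mathbb{F}_q[x]$ of degree $n$. If $n<q^{d/2}+1$, then the graph $G_d(n,q,\alpha)$ is connected.
   Context: $\Gamma_f=(\mathbb{F}_q[x]/(f(x)))^*=\mathbb{F}_q[\alpha]^*=\mathbb{F}_{q^n}^*$. A polynomial $g\in\mathbb{F}_q[x]$ of degree $>0$ is primary if it is a power of an irreducible polynomial. $P_d$ denotes the set of monic primary polynomials of degree $d$ in $\mathbb{F}_q[x]$, and $E_d=\{g(\alpha): g\in P_d\}\subset\Gamma_f$. $G_d(n,q,\alpha)$ is the directed Cayley graph with vertex set $\Gamma_f$ and an edge $\beta_1\to\beta_2$ whenever $\beta_2/\beta_1\in E_d$. Connected means: every element of $\Gamma_f$ is reachable (equivalently, $E_d$ generates the group $\Gamma_f$). *)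

theory Defs
  imports
    "Subresultants.More_Homomorphisms"
    "Graph_Theory.Digraph_Component"
    "Graph_Theory.Pair_Digraph"
    "HOL-Library.Cardinality"
    Complex_Main
begin

definition primary_poly :: "'a::field poly \<Rightarrow> bool" where
  "primary_poly g \<longleftrightarrow> degree g > 0 \<and> (\<exists>p k. irreducible p \<and> g = p ^ k)"

definition monic_primary_polys :: "nat \<Rightarrow> 'a::field poly set" where
  "monic_primary_polys d = {g. lead_coeff g = 1 \<and> primary_poly g \<and> degree g = d}"

text \<open>
  The extension of finite fields is given by two types and an embedding \<open>\<iota>\<close> of the base
  field \<open>'a\<close> into the extension \<open>'b\<close>; the value at \<open>\<alpha>\<close> of a polynomial over \<open>'a\<close>
  is \<open>poly (map_poly \<iota> g) \<alpha>\<close>.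
\<close>

definition primary_values :: "('a::field \<Rightarrow> 'b::field) \<Rightarrow> 'b \<Rightarrow> nat \<Rightarrow> 'b set" where
  "primary_values \<iota> \<alpha> d = (\<lambda>g. poly (map_poly \<iota> g) \<alpha>) ` monic_primary_polys d"

definition primary_digraph ::
    "('a::field \<Rightarrow> 'b::field) \<Rightarrow> 'b \<Rightarrow> nat \<Rightarrow> 'b pair_pre_digraph" where
  "primary_digraph \<iota> \<alpha> d =
     \<lparr> pverts = UNIV - {0},
       parcs = {(\<beta>1, \<beta>2). \<beta>1 \<noteq> 0 \<and> \<beta>2 \<noteq> 0 \<and> \<beta>2 / \<beta>1 \<in> primary_values \<iota> \<alpha> d} \<rparr>"

end

theory Submission
  imports
    Defs
    "HOL-Algebra.Algebraic_Closure_Type"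
    "HOL-Computational_Algebra.Polynomial_FPS"
    "HOL-Computational_Algebra.Fundamental_Theorem_Algebra"
begin

text \<open>
  If the primary values generate a proper subgroup \<open>H\<close> of the cyclic group \<open>\<Gamma>\<^sub>f\<close>, choose a
  nontrivial character \<open>\<chi>\<close> of order \<open>l\<close> that is trivial on \<open>H\<close>. Let \<open>S N\<close> be the sum of
  \<open>deg p * \<chi> (p(\<alpha>) ^ e)\<close> over the powers \<open>p ^ e\<close> of degree \<open>N\<close> of monic irreducible polynomials, and
  \<open>c k\<close> the sum of \<open>\<chi> (g(\<alpha>))\<close> over all monic \<open>g\<close> of degree \<open>k\<close>. Unique factorisation gives
  \<open>k * c k = (\<Sum>N=1..k. S N * c (k - N))\<close>, and \<open>c k = 0\<close> for \<open>k \<ge> n\<close> since \<open>\<chi>\<close> sums to \<open>0\<close>. By Newton's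
  identities \<open>S N\<close> is minus the \<open>N\<close>-th power sum of at most \<open>n - 1\<close> complex numbers. Once these
  have absolute value at most \<open>\<surd>q\<close>, we get \<open>q ^ d = S d \<le> (n - 1) * q ^ (d / 2)\<close>, a contradiction.

  The bound on the absolute values is the Riemann hypothesis for this L-function. It only
  requires \<open>S N = O(q ^ (N / 2))\<close> along the multiples \<open>N = 2 * n * s\<close>, which we get from Stepanov's
  method in Bombieri's form. Grouping the elements \<open>a\<close> of the field with \<open>q ^ N\<close> elements by their
  minimal polynomials, \<open>S N\<close> becomes a sum over \<open>a\<close> of \<open>\<chi>\<close> at the product of
  \<open>\<alpha> - a ^ q ^ i\<close> over \<open>i < N\<close>, which is a power of a fixed polynomial \<open>h\<close> at \<open>a\<close>. So it suffices to
  count the solutions of \<open>h(a) ^ ((q ^ N - 1) / l) = z\<close>.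
\<close>

hide_const (open) up_ring.coeff up_ring.monom Divisibility.irreducible module.smult
  Polynomials.degree Polynomials.lead_coeff

section \<open>Stepanov's method\<close>

text \<open>Gaussian elimination: a member with nonzero coefficient at the top index clears that
  coefficient from the others, leaving one polynomial and one dimension fewer.\<close>

lemma nontrivial_linear_relation:
  fixes p :: "'i \<Rightarrow> 'k::field poly"
  assumes "finite I" and "card I > R" and "\<And>i. i \<in> I \<Longrightarrow> \<forall>m\<ge>R. coeff (p i) m = 0"
  shows "\<exists>c. (\<exists>i\<in>I. c i \<noteq> 0) \<and> (\<Sum>i\<in>I. smult (c i) (p i)) = 0"
  using assms
proof (induction R arbitrary: p I)
  case 0
  then have "p i = 0" if "i \<in> I" for i
    using that by (intro poly_eqI) auto
  moreover obtain i where "i \<in> I" using 0 by fastforce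
  ultimately show ?case by (intro exI[of _ "\<lambda>_. 1"]) auto
next
  case (Suc R)
  show ?case
  proof (cases "\<forall>i\<in>I. coeff (p i) R = 0")
    case True
    have "\<forall>m\<ge>R. coeff (p i) m = 0" if "i \<in> I" for i
      using Suc.prems(3)[OF that] True that by (metis Suc_leI le_neq_implies_less)
    then show ?thesis using Suc.IH[of I p] Suc.prems by simp
  next
    case False
    then obtain k where k: "k \<in> I" "coeff (p k) R \<noteq> 0" by blast
    define r where "r i = coeff (p i) R / coeff (p k) R" for i
    define p' where "p' i = p i - smult (r i) (p k)" for i
    have "\<forall>m\<ge>R. coeff (p' i) m = 0" if "i \<in> I - {k}" for i
    proof (intro allI impI)
      fix m assume "R \<le> m"
      show "coeff (p' i) m = 0"
      proof (cases "m = R")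
        case True
        then show ?thesis using k by (simp add: p'_def r_def)
      next
        case False
        then have "Suc R \<le> m" using \<open>R \<le> m\<close> by simp
        then show ?thesis using Suc.prems(3)[of i] Suc.prems(3)[of k] that k by (simp add: p'_def)
      qed
    qed
    moreover have "card (I - {k}) > R" using Suc.prems k by simp
    ultimately obtain c where c: "\<exists>i\<in>I - {k}. c i \<noteq> 0" "(\<Sum>i\<in>I - {k}. smult (c i) (p' i)) = 0"
      using Suc.IH[of "I - {k}" p'] Suc.prems(1) by blast
    \<comment> \<open>The pivot gets the coefficient that undoes what the elimination subtracted
      from the others.\<close>
    define c' where "c' = c(k := - (\<Sum>i\<in>I - {k}. c i * r i))"
    have "(\<Sum>i\<in>I. smult (c' i) (p i)) = smult (c' k) (p k) + (\<Sum>i\<in>I - {k}. smult (c' i) (p i))"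
      using Suc.prems(1) k by (simp add: sum.remove)
    also have "(\<Sum>i\<in>I - {k}. smult (c' i) (p i)) = (\<Sum>i\<in>I - {k}. smult (c i) (p' i) + smult (c i * r i) (p k))"
      by (intro sum.cong) (auto simp: c'_def p'_def smult_diff_right)
    also have "\<dots> = smult (\<Sum>i\<in>I - {k}. c i * r i) (p k)"
      using c(2) by (simp add: sum.distrib smult_sum)
    finally have "(\<Sum>i\<in>I. smult (c' i) (p i)) = 0"
      by (simp add: c'_def)
    moreover have "\<exists>i\<in>I. c' i \<noteq> 0" using c(1) by (auto simp: c'_def)
    ultimately show ?thesis by blast
  qed
qed

lemma power_sum_of_additive:
  fixes f :: "'i \<Rightarrow> 'k::field"
  assumes "\<And>x y :: 'k. (x + y) ^ P = x ^ P + y ^ P" and "P > 0"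
  shows "(\<Sum>i\<in>I. f i) ^ P = (\<Sum>i\<in>I. f i ^ P)"
  using assms by (induction I rule: infinite_finite_induct) auto

text \<open>
  Write \<open>Q = P\<^sup>2\<close>. The polynomials \<open>x ^ (t + i * P) * h ^ (j * c)\<close> have pairwise different orders of
  vanishing at \<open>0\<close>, so no nontrivial combination \<open>W\<close> of them is \<open>0\<close>. On the points to be counted
  \<open>x ^ Q = x\<close> and \<open>h ^ (c * (P + 1)) = z\<close>, so that \<open>W ^ P * h ^ (l * c)\<close> agrees there with a polynomial
  of so small a degree that it can be made identically \<open>0\<close> by linear algebra.
\<close>

lemma stepanov_bound:
  fixes h :: "'k::alg_closed_field poly"
  assumes add: "\<And>x y :: 'k. (x + y) ^ P = x ^ P + y ^ P"
    and PE: "P \<ge> E + 2" and lc: "l * c = P - 1" and l: "l \<ge> 2"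
    and h: "coeff h 0 = 0" "coeff h 1 \<noteq> 0" "degree h \<le> E" and z: "z \<noteq> 0"
  shows "finite {x. x ^ P\<^sup>2 = x \<and> poly h x ^ (c * (P + 1)) = z}"
    and "card {x. x ^ P\<^sup>2 = x \<and> poly h x ^ (c * (P + 1)) = z} \<le> c * P + (2 * E + 1) * P"
proof -
  \<comment> \<open>Large enough that the \<open>B * (P - 1)\<close> unknowns outnumber the
    \<open>R\<close> conditions, which comes down to \<open>2 * c + E + 2 < 2 * P\<close>; yet
    \<open>degree W\<close> keeps the main term \<open>c * P\<close>.\<close>
  define B where "B = c + E + 1"
  define I where "I = {..<B} \<times> {..<l} \<times> {..<c}"
  \<comment> \<open>What the terms of \<open>W ^ P * h ^ (l * c)\<close> become on the counted
    points: \<open>x ^ P\<^sup>2 = x\<close> lowers \<open>x ^ (i * P * P)\<close> to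
    \<open>x ^ i\<close>, and \<open>j * c * P + l * c = c * (P + 1) * j + (l - j) * c\<close> lets
    \<open>z ^ j\<close> replace most of the power of \<open>h\<close>. The factor
    \<open>h ^ (l * c)\<close> keeps the remaining exponent nonnegative.\<close>
  define p where "p = (\<lambda>(i, j, t). smult (z ^ j) (monom 1 (t * P + i) * h ^ ((l - j) * c)))"
  define R where "R = (c - 1) * P + B + E * (P - 1)"
  have c0: "c > 0" using lc PE by (cases c) auto
  have c2: "2 * c \<le> P - 1" using lc l by (metis mult_le_mono1)
  have finI: "finite I" by (simp add: I_def)
  have "card I = B * (P - 1)" using lc by (simp add: I_def)
  moreover have "R < B * (P - 1)"
  proof -
    obtain P' where P': "P = P' + 2" by (rule that[of "P - 2"]) (use PE in simp)
    obtain c' where c': "c = Suc c'" by (rule that[of "c - 1"]) (use c0 in simp)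
    have "R = c' * P' + E * P' + (3 * c' + 2 * E + 2)"
      by (simp add: R_def B_def P' c' algebra_simps)
    moreover have "B * (P - 1) = c' * P' + E * P' + (c' + E + 2 * P' + 2)"
      by (simp add: B_def P' c' algebra_simps)
    moreover have "3 * c' + 2 * E + 2 < c' + E + 2 * P' + 2"
      using c2 PE P' c' by linarith
    ultimately show ?thesis by (simp only: add_less_cancel_left)
  qed
  ultimately have cardI: "card I > R" by simp
  have deg: "\<forall>m\<ge>R. coeff (p k) m = 0" if "k \<in> I" for k
  proof -
    obtain i j t where k: "k = (i, j, t)" "i < B" "j < l" "t < c"
      using \<open>k \<in> I\<close> by (auto simp: I_def)
    have "degree (p k) \<le> degree (monom (1::'k) (t * P + i)) + degree (h ^ ((l - j) * c))"
      by (auto simp: k p_def intro: order_trans[OF degree_smult_le] degree_mult_le)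
    also have "\<dots> \<le> (t * P + i) + E * (P - 1)"
    proof (intro add_mono)
      have "degree (h ^ ((l - j) * c)) \<le> degree h * ((l - j) * c)" by (rule degree_power_le)
      also have "\<dots> \<le> E * (l * c)" using h by (intro mult_mono) auto
      finally show "degree (h ^ ((l - j) * c)) \<le> E * (P - 1)" using lc by simp
    qed (simp add: degree_monom_eq)
    also have "\<dots> < R"
    proof -
      have "t * P \<le> (c - 1) * P" using k by (intro mult_right_mono) auto
      then show ?thesis using k(2) unfolding R_def by linarith
    qed
    finally show ?thesis by (auto intro: coeff_eq_0)
  qed
  have "\<exists>a. (\<exists>k\<in>I. a k \<noteq> 0) \<and> (\<Sum>k\<in>I. smult (a k) (p k)) = 0"
    by (rule nontrivial_linear_relation[OF finI cardI deg])
  then obtain a where a: "\<exists>k\<in>I. a k \<noteq> 0" "(\<Sum>k\<in>I. smult (a k) (p k)) = 0"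
    by (elim exE conjE)
  \<comment> \<open>Raising to the power \<open>P\<close> is additive, so the relation found
    concerns the \<open>P\<close>-th powers of the coefficients of \<open>W\<close>. The
    algebraically closed field supplies the roots.\<close>
  have "\<exists>y. y ^ P = a k" for k
    using nth_root_exists[of P "a k"] PE by auto
  then obtain b where b: "b k ^ P = a k" for k by metis
  define w where "w = (\<lambda>(i, j, t). monom 1 (t + i * P) * h ^ (j * c))"
  define W where "W = (\<Sum>k\<in>I. smult (b k) (w k))"
  \<comment> \<open>The order of vanishing of \<open>w\<close> at \<open>0\<close>, to which the
    simple root of \<open>h\<close> contributes \<open>j * c\<close>. As \<open>t < c\<close> and
    \<open>j * c + t < l * c < P\<close>, the triple can be read off from \<open>u\<close> as digits
    in mixed radix.\<close>
  define u where "u = (\<lambda>(i, j, t). i * P + (j * c + t))"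
  have inner: "j * c + t < P" if "j < l" "t < c" for j t
  proof -
    have "j * c + t < Suc j * c" using that by simp
    also have "\<dots> \<le> l * c" using that by (intro mult_right_mono) auto
    finally show ?thesis using lc by simp
  qed
  have inj: "inj_on u I"
  proof (intro inj_onI)
    fix k k' assume k: "k \<in> I" "k' \<in> I" "u k = u k'"
    obtain i j t where 1: "k = (i, j, t)" "j < l" "t < c" using k by (auto simp: I_def)
    obtain i' j' t' where 2: "k' = (i', j', t')" "j' < l" "t' < c" using k by (auto simp: I_def)
    have e: "i * P + (j * c + t) = i' * P + (j' * c + t')" using k 1 2 by (simp add: u_def)
    have "(i * P + (j * c + t)) div P = i" "(i' * P + (j' * c + t')) div P = i'"
      using inner 1 2 PE by simp_all
    with e have i: "i = i'" by simp
    with e have e: "j * c + t = j' * c + t'" by simp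
    have "(j * c + t) div c = j" "(j' * c + t') div c = j'" using 1 2 c0 by simp_all
    with e i 1 2 show "k = k'" by auto
  qed
  define g where "g = Polynomial.poly_shift 1 h"
  have hg: "h = monom 1 1 * g"
    by (intro poly_eqI) (use h in \<open>auto simp: g_def coeff_monom_mult coeff_poly_shift not_less_eq_eq\<close>)
  have g0: "coeff g 0 \<noteq> 0" using h by (simp add: g_def coeff_poly_shift)
  have w: "w k = monom 1 (u k) * g ^ (fst (snd k) * c)" for k
    by (cases k) (simp add: w_def u_def hg power_mult_distrib monom_power mult_monom flip: mult.assoc, simp add: algebra_simps)
  have "W \<noteq> 0"
  proof -
    \<comment> \<open>Among the terms with nonzero coefficient, only the one with the least
      \<open>u\<close> contributes to the coefficient of \<open>W\<close> at that index.\<close>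
    define S where "S = {k \<in> I. b k \<noteq> 0}"
    have "finite S" using finI by (simp add: S_def)
    moreover have "S \<noteq> {}"
    proof -
      from a obtain k where "k \<in> I" "a k \<noteq> 0" by blast
      then have "b k \<noteq> 0" using b[of k] PE by (auto simp: power_0_left)
      then have "k \<in> S" using \<open>k \<in> I\<close> by (simp add: S_def)
      then show ?thesis by blast
    qed
    ultimately obtain k0 where k0: "k0 \<in> S" and min: "\<And>k. k \<in> S \<Longrightarrow> u k0 \<le> u k"
      using ex_min_if_finite[of "u ` S"] by (metis (no_types, lifting) arg_min_if_finite(1) arg_min_least)
    have "coeff W (u k0) = (\<Sum>k\<in>I. b k * coeff (w k) (u k0))"
      by (simp add: W_def coeff_sum)
    also have "\<dots> = b k0 * coeff (w k0) (u k0) + (\<Sum>k\<in>I-{k0}. b k * coeff (w k) (u k0))"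
      using k0 finI by (intro sum.remove) (auto simp: S_def)
    also have "(\<Sum>k\<in>I-{k0}. b k * coeff (w k) (u k0)) = 0"
    proof (intro sum.neutral ballI)
      fix k assume k: "k \<in> I - {k0}"
      show "b k * coeff (w k) (u k0) = 0"
      proof (cases "b k = 0")
        case False
        then have "u k0 \<le> u k" using min k by (auto simp: S_def)
        moreover have "u k \<noteq> u k0" using inj k k0 by (auto simp: inj_on_def S_def)
        ultimately show ?thesis by (simp add: w coeff_monom_mult)
      qed simp
    qed
    also have "b k0 * coeff (w k0) (u k0) + 0 = b k0 * coeff g 0 ^ (fst (snd k0) * c)"
      by (simp add: w coeff_monom_mult coeff_0_power)
    finally have "coeff W (u k0) \<noteq> 0" using g0 k0 by (simp add: S_def)
    then show ?thesis by auto
  qed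
  have "degree W \<le> c * P + (2 * E + 1) * P"
    unfolding W_def
  proof (intro degree_sum_le)
    fix k assume "k \<in> I"
    then obtain i j t where k: "k = (i, j, t)" "i < B" "j < l" "t < c"
      by (auto simp: I_def)
    have "degree (smult (b k) (w k)) \<le> degree (monom (1::'k) (t + i * P)) + degree (h ^ (j * c))"
      by (auto simp: k w_def intro: order_trans[OF degree_smult_le] degree_mult_le)
    also have "\<dots> \<le> (t + i * P) + E * (P - 1)"
    proof (intro add_mono)
      have "degree (h ^ (j * c)) \<le> degree h * (j * c)" by (rule degree_power_le)
      also have "\<dots> \<le> E * (l * c)" using h k by (intro mult_mono) auto
      finally show "degree (h ^ (j * c)) \<le> E * (P - 1)" using lc by simp
    qed (simp add: degree_monom_eq)
    also have "\<dots> \<le> P + (c + E) * P + E * P"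
    proof -
      have "t \<le> P" using k c2 by simp
      moreover have "i * P \<le> (c + E) * P" using k by (intro mult_right_mono) (auto simp: B_def)
      moreover have "E * (P - 1) \<le> E * P" by simp
      ultimately show ?thesis by linarith
    qed
    also have "\<dots> = c * P + (2 * E + 1) * P" by (simp add: algebra_simps)
    finally show "degree (smult (b k) (w k)) \<le> c * P + (2 * E + 1) * P" .
  qed (rule finI)
  moreover have "{x. x ^ P\<^sup>2 = x \<and> poly h x ^ (c * (P + 1)) = z} \<subseteq> {x. poly W x = 0}"
  proof safe
    fix x assume x: "x ^ P\<^sup>2 = x" "z = poly h x ^ (c * (P + 1))"
    define y where "y = poly h x"
    have y0: "y \<noteq> 0" using z x PE c0 by (auto simp: y_def)
    have "poly W x ^ P * y ^ (l * c) = (\<Sum>k\<in>I. (b k * poly (w k) x) ^ P) * y ^ (l * c)"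
      unfolding W_def poly_sum using PE by (simp add: power_sum_of_additive[OF add])
    also have "\<dots> = (\<Sum>k\<in>I. a k * poly (p k) x)"
      unfolding sum_distrib_right
    proof (intro sum.cong refl)
      fix k assume "k \<in> I"
      then obtain i j t where k: "k = (i, j, t)" "j < l" by (auto simp: I_def)
      have "(x ^ (t + i * P)) ^ P = x ^ (t * P) * (x ^ P\<^sup>2) ^ i"
        by (simp add: power2_eq_square flip: power_mult power_add) (simp add: algebra_simps)
      then have 1: "(x ^ (t + i * P)) ^ P = x ^ (t * P + i)" using x(1) by (simp add: power_add)
      have "j * c * P + l * c = c * (P + 1) * j + (l - j) * c"
      proof -
        obtain m where "l = j + m" using k(2) by (metis less_imp_add_positive)
        then show ?thesis by (simp add: algebra_simps)
      qed
      then have 2: "(y ^ (j * c)) ^ P * y ^ (l * c) = (y ^ (c * (P + 1))) ^ j * y ^ ((l - j) * c)"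
        by (simp flip: power_mult power_add)
      have "(b k * poly (w k) x) ^ P * y ^ (l * c)
          = a k * ((x ^ (t + i * P)) ^ P * ((y ^ (j * c)) ^ P * y ^ (l * c)))"
        by (simp add: k w_def y_def poly_monom power_mult_distrib flip: b)
      also have "\<dots> = a k * poly (p k) x"
        unfolding 1 2 by (simp add: k p_def poly_monom x(2) y_def)
      finally show "(b k * poly (w k) x) ^ P * y ^ (l * c) = a k * poly (p k) x" .
    qed
    also have "\<dots> = poly (\<Sum>k\<in>I. smult (a k) (p k)) x" by (simp add: poly_sum)
    also have "\<dots> = 0" by (simp add: a(2))
    finally show "poly W x = 0" using y0 by simp
  qed
  moreover have "finite {x. poly W x = 0}" "card {x. poly W x = 0} \<le> degree W"
    using \<open>W \<noteq> 0\<close> by (simp_all add: poly_roots_finite card_poly_roots_bound)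
  ultimately show "finite {x. x ^ P\<^sup>2 = x \<and> poly h x ^ (c * (P + 1)) = z}"
    and "card {x. x ^ P\<^sup>2 = x \<and> poly h x ^ (c * (P + 1)) = z} \<le> c * P + (2 * E + 1) * P"
    by (meson finite_subset, meson card_mono order_trans)
qed

section \<open>Power sums\<close>

lemma norm_sum_powers_le:
  fixes w :: complex
  assumes "norm w \<le> 1" and "w \<noteq> 1"
  shows "norm (\<Sum>s<T. w ^ s) \<le> 2 / norm (1 - w)"
proof -
  have "norm (1 - w ^ T) \<le> norm (1::complex) + norm (w ^ T)" by (rule norm_triangle_ineq4)
  also have "\<dots> \<le> 2" using assms(1) by (simp add: norm_power power_le_one)
  finally show ?thesis
    using assms(2) by (simp add: sum_gp_strict norm_divide divide_right_mono)
qed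

text \<open>After normalising by a number of largest modulus, the power sums have a positive average,
  unless they grow at least as fast as the powers of that modulus.\<close>

lemma power_sums_bound:
  fixes z :: "'i \<Rightarrow> complex"
  assumes fin: "finite I" and bd: "\<And>s. s \<ge> s0 \<Longrightarrow> norm (\<Sum>i\<in>I. z i ^ s) \<le> C * r ^ s"
    and r: "r > 0" and k: "k \<in> I"
  shows "norm (z k) \<le> r"
proof -
  define \<rho> where "\<rho> = Max ((\<lambda>i. norm (z i)) ` I)"
  have "\<rho> \<in> (\<lambda>i. norm (z i)) ` I" unfolding \<rho>_def using fin k by (intro Max_in) auto
  then obtain m where m: "m \<in> I" "\<rho> = norm (z m)" by blast
  have le: "norm (z i) \<le> \<rho>" if "i \<in> I" for i
    unfolding \<rho>_def using fin that by (intro Max_ge) auto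
  have "\<not> \<rho> > r"
  proof
    assume \<rho>: "\<rho> > r"
    have zm: "z m \<noteq> 0" using \<rho> r m by auto
    define w where "w i = z i / z m" for i
    have w1: "norm (w i) \<le> 1" if "i \<in> I" for i
      using le[OF that] m zm by (simp add: w_def norm_divide)
    \<comment> \<open>An index with \<open>w i = 1\<close> enters with \<open>2 / 0 = 0\<close>,
      which is right: its partial sum is \<open>T\<close> and needs no correction. The other
      geometric sums stay bounded.\<close>
    define D where "D = (\<Sum>i\<in>I-{m}. 2 / norm (1 - w i))"
    define x where "x = r / \<rho>"
    have x: "0 < x" "x < 1" using r \<rho> by (auto simp: x_def)
    have C: "C \<ge> 0"
      using order_trans[OF norm_ge_zero bd[of s0]] zero_less_power[OF r, of s0]
      by (auto simp: zero_le_mult_iff)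
    define p where "p s = (\<Sum>i\<in>I. w i ^ s)" for s
    have p: "norm (p s) \<le> C * x ^ s" if "s \<ge> s0" for s
    proof -
      have "p s = (\<Sum>i\<in>I. z i ^ s) / z m ^ s"
        by (simp add: p_def w_def power_divide sum_divide_distrib)
      then have "norm (p s) = norm (\<Sum>i\<in>I. z i ^ s) / \<rho> ^ s"
        using m by (simp add: norm_divide norm_power)
      also have "\<dots> \<le> C * r ^ s / \<rho> ^ s"
        using bd[OF that] m by (intro divide_right_mono) auto
      finally show ?thesis by (simp add: x_def power_divide)
    qed
    \<comment> \<open>From \<open>s0\<close> on the \<open>p s\<close> decay geometrically because
      \<open>r < \<rho>\<close>. So \<open>K\<close> bounds all partial sums, while the lower bound
      \<open>T - D\<close> grows with \<open>T\<close>.\<close>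
    define K where "K = (\<Sum>s<s0. norm (p s)) + C * (1 / (1 - x))"
    have upper: "norm (\<Sum>s<T. p s) \<le> K" for T
    proof -
      have "norm (\<Sum>s<T. p s) \<le> (\<Sum>s<T. norm (p s))" by (rule norm_sum)
      also have "\<dots> \<le> (\<Sum>s<T. (if s < s0 then norm (p s) else 0) + C * x ^ s)"
        using p C x by (intro sum_mono) auto
      also have "\<dots> = (\<Sum>s<T. if s < s0 then norm (p s) else 0) + C * (\<Sum>s<T. x ^ s)"
        by (simp add: sum.distrib sum_distrib_left)
      also have "\<dots> \<le> K"
        unfolding K_def
      proof (intro add_mono mult_left_mono C)
        have "(\<Sum>s<T. if s < s0 then norm (p s) else 0) = (\<Sum>s\<in>{..<T} \<inter> {s. s < s0}. norm (p s))"
          by (simp add: sum.inter_restrict)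
        also have "\<dots> \<le> (\<Sum>s<s0. norm (p s))"
          by (intro sum_mono2) auto
        finally show "(\<Sum>s<T. if s < s0 then norm (p s) else 0) \<le> (\<Sum>s<s0. norm (p s))" .
        show "(\<Sum>s<T. x ^ s) \<le> 1 / (1 - x)"
          using x by (simp add: sum_gp_strict divide_right_mono)
      qed
      finally show ?thesis .
    qed
    have lower: "real T - D \<le> norm (\<Sum>s<T. p s)" for T
    proof -
      have "(\<Sum>s<T. p s) = (\<Sum>i\<in>I. \<Sum>s<T. w i ^ s)"
        unfolding p_def by (rule sum.swap)
      then have "Re (\<Sum>s<T. p s) = (\<Sum>i\<in>I. Re (\<Sum>s<T. w i ^ s))"
        by simp
      also have "\<dots> = Re (\<Sum>s<T. w m ^ s) + (\<Sum>i\<in>I-{m}. Re (\<Sum>s<T. w i ^ s))"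
        using fin m by (simp add: sum.remove)
      also have "Re (\<Sum>s<T. w m ^ s) = real T" using zm by (simp add: w_def)
      finally have "Re (\<Sum>s<T. p s) = real T + (\<Sum>i\<in>I-{m}. Re (\<Sum>s<T. w i ^ s))" .
      moreover have "(\<Sum>i\<in>I-{m}. Re (\<Sum>s<T. w i ^ s)) \<ge> (\<Sum>i\<in>I-{m}. - (2 / norm (1 - w i)))"
      proof (intro sum_mono)
        fix i assume i: "i \<in> I - {m}"
        show "- (2 / norm (1 - w i)) \<le> Re (\<Sum>s<T. w i ^ s)"
        proof (cases "w i = 1")
          case False
          then have "norm (\<Sum>s<T. w i ^ s) \<le> 2 / norm (1 - w i)"
            using w1 i by (intro norm_sum_powers_le) auto
          then show ?thesis using abs_Re_le_cmod[of "\<Sum>s<T. w i ^ s"] by linarith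
        qed simp
      qed
      ultimately have "real T - D \<le> Re (\<Sum>s<T. p s)" unfolding D_def sum_negf by linarith
      then show ?thesis using abs_Re_le_cmod[of "\<Sum>s<T. p s"] by linarith
    qed
    obtain T :: nat where "real T > K + D" using reals_Archimedean2 by blast
    with upper[of T] lower[of T] show False by linarith
  qed
  with le[OF k] show ?thesis by linarith
qed

section \<open>Newton's identities via logarithmic derivatives\<close>

lemma complex_poly_linear_factors:
  fixes p :: "complex poly"
  assumes "coeff p 0 = 1"
  shows "\<exists>w. p = (\<Prod>i<degree p. [:1, - w i:])"
  using assms
proof (induction "degree p" arbitrary: p)
  case 0
  then have "degree p = 0" by simp
  then obtain a where "p = [:a:]" by (rule degree_eq_zeroE)
  with 0 show ?case by simp
next
  case (Suc d)
  then have "\<not> constant (poly p)" by (simp add: constant_degree)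
  then obtain z where z: "poly p z = 0" using fundamental_theorem_of_algebra by blast
  then obtain s where s: "p = [:-z, 1:] * s" unfolding poly_eq_0_iff_dvd by (rule dvdE)
  have z0: "z \<noteq> 0" using z Suc.prems by (auto simp: poly_0_coeff_0)
  \<comment> \<open>The factor \<open>-z\<close> turns \<open>x - z\<close> into
    \<open>1 - x / z\<close>: the \<open>w i\<close> are the reciprocals of the roots, and the
    constant term \<open>1\<close> passes on to \<open>t\<close>.\<close>
  define t where "t = smult (-z) s"
  have p: "p = t * [:1, - (1 / z):]"
    using z0 unfolding t_def s by simp
  have "t \<noteq> 0" using p Suc.prems by auto
  then have "degree p = degree t + 1"
    unfolding p by (subst degree_mult_eq) (use z0 in auto)
  then have dt: "d = degree t" using Suc.hyps by simp
  moreover have "coeff t 0 = 1" using Suc.prems unfolding p by (simp add: coeff_mult)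
  ultimately obtain w where w: "t = (\<Prod>i<degree t. [:1, - w i:])"
    using Suc.hyps(1)[of t] by blast
  have "p = (\<Prod>i<d. [:1, - w i:]) * [:1, - (1 / z):]"
    unfolding p using w dt by simp
  also have "\<dots> = (\<Prod>i<Suc d. [:1, - (w(d := 1 / z)) i:])" by simp
  finally show ?case using Suc.hyps(2) by metis
qed

text \<open>Up to sign, the logarithmic derivative turns the product into a sum of geometric series
  \<open>w x / (1 - w x)\<close>. Multiplying out avoids division of power series.\<close>

lemma fps_log_deriv_linear_factors:
  fixes w :: "nat \<Rightarrow> complex"
  shows "fps_X * fps_deriv (\<Prod>i<k. 1 - fps_const (w i) * fps_X)
    = - (\<Prod>i<k. 1 - fps_const (w i) * fps_X) * Abs_fps (\<lambda>N. if N = 0 then 0 else \<Sum>i<k. w i ^ N)"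
proof (induction k)
  case 0
  show ?case by (simp add: fps_eq_iff)
next
  case (Suc k)
  define L where "L = (\<Prod>i<k. 1 - fps_const (w i) * fps_X)"
  define G where "G = Abs_fps (\<lambda>N. if N = 0 then 0 else \<Sum>i<k. w i ^ N)"
  define g where "g = Abs_fps (\<lambda>N. if N = 0 then 0 else w k ^ N)"
  have g: "(1 - fps_const (w k) * fps_X) * g = fps_const (w k) * fps_X"
  proof (rule fps_ext)
    fix m show "fps_nth ((1 - fps_const (w k) * fps_X) * g) m = fps_nth (fps_const (w k) * fps_X) m"
      by (cases m) (auto simp: g_def left_diff_distrib mult.assoc)
  qed
  have "Abs_fps (\<lambda>N. if N = 0 then 0 else \<Sum>i<Suc k. w i ^ N) = G + g"
    by (rule fps_ext) (simp add: G_def g_def)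
  moreover have "fps_X * fps_deriv (L * (1 - fps_const (w k) * fps_X))
      = - (L * (1 - fps_const (w k) * fps_X)) * (G + g)"
  proof -
    have "fps_X * fps_deriv (L * (1 - fps_const (w k) * fps_X))
      = (fps_X * fps_deriv L) * (1 - fps_const (w k) * fps_X) - L * (fps_const (w k) * fps_X)"
      by (simp add: algebra_simps)
    also have "fps_X * fps_deriv L = - L * G" using Suc.IH by (simp add: L_def G_def)
    also have "L * (fps_const (w k) * fps_X) = L * ((1 - fps_const (w k) * fps_X) * g)"
      by (simp only: g)
    finally show ?thesis by (simp add: algebra_simps)
  qed
  ultimately show ?case by (simp add: L_def)
qed

text \<open>With \<open>L\<close> the polynomial with coefficients \<open>c\<close> and
  \<open>G\<close> the series of \<open>S\<close>, the recursion reads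
  \<open>x * L' = L * G\<close>. The linear factors of \<open>L\<close> give the same equation for
  the negated power sums, and \<open>L\<close> cancels.\<close>

lemma newton_power_sums:
  fixes c S :: "nat \<Rightarrow> complex"
  assumes c0: "c 0 = 1" and cn: "\<And>k. k \<ge> n \<Longrightarrow> c k = 0"
    and rec: "\<And>k. of_nat k * c k = (\<Sum>N=1..k. S N * c (k - N))"
  shows "\<exists>k w. k \<le> n - 1 \<and> (\<forall>N\<ge>1. S N = - (\<Sum>i<k. w i ^ N))"
proof -
  define p where "p = Abs_poly c"
  have cp: "coeff p = c"
    unfolding p_def using cn by (intro coeff_Abs_poly[of "n - 1"]) auto
  then have "degree p \<le> n - 1" using cn by (intro degree_le) auto
  obtain w where w: "p = (\<Prod>i<degree p. [:1, - w i:])"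
    using complex_poly_linear_factors[of p] c0 cp by auto
  define k where "k = degree p"
  define L where "L = (\<Prod>i<k. 1 - fps_const (w i) * fps_X)"
  have "fps_of_poly p = L"
    by (subst w) (simp add: k_def L_def fps_of_poly_prod fps_of_poly_pCons mult.commute
      fps_const_neg[symmetric] del: fps_const_neg)
  then have L: "fps_nth L m = c m" for m using cp by auto
  define G where "G = Abs_fps (\<lambda>N. if N = 0 then 0 else S N)"
  have LG: "fps_X * fps_deriv L = L * G"
  proof (rule fps_ext)
    fix m
    have "fps_nth (fps_X * fps_deriv L) m = of_nat m * c m" by (cases m) (simp_all add: L)
    also have "\<dots> = (\<Sum>N=1..m. S N * c (m - N))" by (rule rec)
    also have "\<dots> = (\<Sum>N=0..m. fps_nth G N * c (m - N))"
      by (intro sum.mono_neutral_cong_left) (auto simp: G_def)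
    also have "\<dots> = fps_nth (G * L) m" by (simp add: fps_mult_nth L)
    finally show "fps_nth (fps_X * fps_deriv L) m = fps_nth (L * G) m" by (simp add: mult.commute)
  qed
  define H where "H = - Abs_fps (\<lambda>N. if N = 0 then 0 else \<Sum>i<k. w i ^ N)"
  have LH: "fps_X * fps_deriv L = L * H"
    using fps_log_deriv_linear_factors[of w k] by (simp add: L_def H_def)
  have "L \<noteq> 0" using L[of 0] c0 by auto
  moreover have "L * G = L * H" using LG LH by (rule trans[OF sym])
  ultimately have "G = H" by (simp only: mult_cancel_left) simp
  have "S N = - (\<Sum>i<k. w i ^ N)" if "N \<ge> 1" for N
  proof -
    have "S N = fps_nth G N" using that by (simp add: G_def)
    then show ?thesis using that by (simp add: \<open>G = H\<close> H_def)
  qed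
  then show ?thesis using \<open>degree p \<le> n - 1\<close> by (auto simp: k_def)
qed

text \<open>A bound along the multiples of \<open>M\<close> suffices, because it concerns the power
  sums of the numbers \<open>w i ^ M\<close>. The constant \<open>C\<close> disappears in passing to
  the moduli of the \<open>w i\<close>, which then bound \<open>S\<close> at every index.\<close>

lemma riemann_hypothesis_from_weak_bound:
  fixes c S :: "nat \<Rightarrow> complex"
  assumes c0: "c 0 = 1" and cn: "\<And>k. k \<ge> n \<Longrightarrow> c k = 0"
    and rec: "\<And>k. of_nat k * c k = (\<Sum>N=1..k. S N * c (k - N))"
    and bd: "\<And>s. s \<ge> s0 \<Longrightarrow> norm (S (M * s)) \<le> C * (\<rho> ^ M) ^ s"
    and M: "M \<ge> 1" and \<rho>: "\<rho> > 0" and d: "d \<ge> 1"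
  shows "norm (S d) \<le> real (n - 1) * \<rho> ^ d"
proof -
  obtain k w where k: "k \<le> n - 1" and w: "\<And>N. N \<ge> 1 \<Longrightarrow> S N = - (\<Sum>i<k. w i ^ N)"
    using newton_power_sums[OF c0 cn rec] by blast
  have "norm (w i) \<le> \<rho>" if "i < k" for i
  proof -
    \<comment> \<open>\<open>Suc s0\<close> makes \<open>M * s\<close> positive, where the power sum
      formula for \<open>S\<close> applies.\<close>
    have bound: "norm (\<Sum>i<k. (w i ^ M) ^ s) \<le> C * (\<rho> ^ M) ^ s" if "s \<ge> Suc s0" for s
      using bd[of s] w[of "M * s"] that M by (simp add: power_mult)
    have "norm (w i ^ M) \<le> \<rho> ^ M"
      by (rule power_sums_bound[where I = "{..<k}" and z = "\<lambda>i. w i ^ M", OF _ bound])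
        (use that \<rho> in simp_all)
    then show ?thesis using \<rho> M by (simp add: norm_power power_mono_iff)
  qed
  then have "norm (S d) \<le> (\<Sum>i<k. \<rho> ^ d)"
    unfolding w[OF d] norm_minus_cancel
    by (intro sum_norm_le) (auto simp: norm_power intro!: power_mono)
  also have "\<dots> \<le> real (n - 1) * \<rho> ^ d" using k \<rho> by (simp add: mult_right_mono)
  finally show ?thesis .
qed

section \<open>Polynomials over a finite field and conjugates\<close>

text \<open>Coefficients instead of \<open>degree g < n\<close>: for \<open>n = 0\<close> this still
  contains the zero polynomial, whose degree is \<open>0\<close>.\<close>

definition polys_below :: "nat \<Rightarrow> 'a::zero poly set" where
  "polys_below n = {g. \<forall>i\<ge>n. coeff g i = 0}"

lemma polys_below_0: "polys_below 0 = {0}"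
  by (auto simp: polys_below_def intro: poly_eqI)

lemma polys_below_Suc: "polys_below (Suc n) = (\<lambda>(a, g). pCons a g) ` (UNIV \<times> polys_below n)"
proof (intro equalityI subsetI)
  fix g :: "'a poly" assume g: "g \<in> polys_below (Suc n)"
  obtain a h where h: "g = pCons a h" by (cases g)
  have "h \<in> polys_below n"
    unfolding polys_below_def
  proof (intro CollectI allI impI)
    fix i assume "n \<le> i"
    then have "coeff g (Suc i) = 0" using g by (simp add: polys_below_def)
    then show "coeff h i = 0" by (simp add: h)
  qed
  then show "g \<in> (\<lambda>(a, g). pCons a g) ` (UNIV \<times> polys_below n)" using h by auto
next
  fix g :: "'a poly" assume "g \<in> (\<lambda>(a, g). pCons a g) ` (UNIV \<times> polys_below n)"
  then show "g \<in> polys_below (Suc n)"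
    by (auto simp: polys_below_def coeff_pCons split: nat.split)
qed

lemma finite_polys_below: "finite (polys_below n :: 'a::{zero,finite} poly set)"
  by (induction n) (simp_all add: polys_below_0 polys_below_Suc)

lemma card_polys_below: "card (polys_below n :: 'a::{zero,finite} poly set) = CARD('a) ^ n"
proof (induction n)
  case (Suc n)
  have "inj_on (\<lambda>(a, g :: 'a poly). pCons a g) (UNIV \<times> polys_below n)"
    by (auto simp: inj_on_def)
  then show ?case
    by (simp add: polys_below_Suc card_image card_cartesian_product Suc)
qed (simp add: polys_below_0)

text \<open>Multiplication by a nonzero \<open>x\<close> permutes the nonzero elements, so the
  factor \<open>x ^ (CARD('a) - 1)\<close> leaves their product unchanged.\<close>

lemma finite_field_power_card:
  fixes x :: "'a::{field,finite}"
  shows "x ^ CARD('a) = x"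
proof (cases "x = 0")
  case False
  have "(\<Prod>y\<in>UNIV - {0}. x * y) = (\<Prod>y\<in>UNIV - {0}. y)"
    by (rule prod.reindex_bij_witness[of _ "\<lambda>y. y / x" "\<lambda>y. x * y"]) (use False in auto)
  then have "x ^ (CARD('a) - 1) * (\<Prod>y\<in>UNIV - {0::'a}. y) = (\<Prod>y\<in>UNIV - {0}. y)"
    by (simp add: prod.distrib card_Diff_singleton)
  moreover have "(\<Prod>y\<in>UNIV - {0::'a}. y) \<noteq> 0" by simp
  ultimately have "x ^ (CARD('a) - 1) = 1" by simp
  then have "x * x ^ (CARD('a) - 1) = x" by simp
  then show ?thesis by (simp flip: power_Suc)
qed simp

lemma two_le_CARD_field: "2 \<le> CARD('a::{field,finite})"
proof -
  have "card {0, 1 :: 'a} \<le> CARD('a)" by (intro card_mono) auto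
  then show ?thesis by simp
qed

text \<open>As \<open>x ^ q = x\<close> on the field, the middle part of the expansion of
  \<open>(x + 1) ^ q\<close> vanishes at all \<open>q\<close> elements, but its degree is less than
  \<open>q\<close>. So its coefficients are \<open>0\<close>, without recourse to the
  characteristic.\<close>

lemma binomial_CARD_eq_0:
  assumes "0 < i" and "i < CARD('a)"
  shows "of_nat (CARD('a) choose i) = (0 :: 'a::{field,finite})"
proof -
  define q where "q = CARD('a)"
  define r :: "'a poly" where "r = (\<Sum>i\<in>{1..<q}. monom (of_nat (q choose i)) i)"
  have q: "q \<ge> 2" using two_le_CARD_field by (simp add: q_def)
  have "poly r x = 0" for x :: 'a
  proof -
    have "(x + 1) ^ q = (\<Sum>i\<le>q. of_nat (q choose i) * x ^ i)"
      by (simp add: binomial_ring)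
    also have "{..q} = insert 0 (insert q {1..<q})" using q by auto
    also have "(\<Sum>i\<in>\<dots>. of_nat (q choose i) * x ^ i) = 1 + x ^ q + poly r x"
      using q by (simp add: r_def poly_sum poly_monom)
    finally show ?thesis using finite_field_power_card[of x] finite_field_power_card[of "x + 1"]
      by (simp add: q_def)
  qed
  moreover have "degree r < q"
    unfolding r_def by (intro degree_sum_less le_less_trans[OF degree_monom_le]) (use q in auto)
  ultimately have "r = 0"
    by (intro poly_eqI_degree[of UNIV]) (use q in \<open>auto simp: q_def\<close>)
  then have "coeff r i = 0" by simp
  then show ?thesis using assms by (simp add: r_def coeff_sum q_def)
qed

section \<open>Frobenius powers and conjugates in an extension field\<close>

locale finite_field_hom = field_hom hom
  for hom :: "'a::{field,finite} \<Rightarrow> 'k::field"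
begin

sublocale map_poly_hom: map_poly_inj_idom_hom hom ..

definition eval :: "'a poly \<Rightarrow> 'k \<Rightarrow> 'k" where
  "eval g x = poly (map_poly hom g) x"

lemma eval_simps [simp]:
  "eval 0 x = 0" "eval 1 x = 1"
  "eval (g + h) x = eval g x + eval h x"
  "eval (g - h) x = eval g x - eval h x"
  "eval (g * h) x = eval g x * eval h x"
  "eval (g ^ n) x = eval g x ^ n"
  "eval (pCons a g) x = hom a + x * eval g x"
  by (simp_all add: eval_def hom_distribs map_poly_hom.hom_mult map_poly_hom.hom_power map_poly_hom.hom_minus)

text \<open>The vanishing of the binomial coefficients passes from \<open>'a\<close> to
  \<open>'k\<close> through \<open>hom\<close>, so that \<open>'k\<close> may be an algebraic
  closure.\<close>

lemma frobenius_add: "(x + y :: 'k) ^ CARD('a) ^ m = x ^ CARD('a) ^ m + y ^ CARD('a) ^ m"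
proof (induction m)
  case (Suc m)
  have *: "(x + y :: 'k) ^ CARD('a) = x ^ CARD('a) + y ^ CARD('a)" for x y
  proof -
    have "(x + y) ^ CARD('a) = (\<Sum>i\<le>CARD('a). of_nat (CARD('a) choose i) * x ^ i * y ^ (CARD('a) - i))"
      by (simp add: binomial_ring)
    also have "\<dots> = (\<Sum>i\<in>{0, CARD('a)}. of_nat (CARD('a) choose i) * x ^ i * y ^ (CARD('a) - i))"
    proof (intro sum.mono_neutral_right ballI)
      fix i assume "i \<in> {..CARD('a)} - {0, CARD('a)}"
      then have "of_nat (CARD('a) choose i) = (0 :: 'a)" by (intro binomial_CARD_eq_0) auto
      then have "hom (of_nat (CARD('a) choose i)) = 0" by simp
      then have "of_nat (CARD('a) choose i) = (0 :: 'k)" by (simp add: hom_of_nat)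
      then show "of_nat (CARD('a) choose i) * x ^ i * y ^ (CARD('a) - i) = 0" by simp
    qed auto
    also have "\<dots> = x ^ CARD('a) + y ^ CARD('a)" using zero_less_card_finite[where 'a='a] by simp
    finally show ?thesis .
  qed
  have "(x + y) ^ CARD('a) ^ Suc m = ((x + y) ^ CARD('a) ^ m) ^ CARD('a)" by (simp flip: power_mult add: mult.commute)
  also have "\<dots> = (x ^ CARD('a) ^ m) ^ CARD('a) + (y ^ CARD('a) ^ m) ^ CARD('a)" by (simp only: Suc *)
  finally show ?case by (simp flip: power_mult add: mult.commute)
qed simp

lemma frobenius_inj:
  assumes "x ^ CARD('a) ^ m = (y :: 'k) ^ CARD('a) ^ m" shows "x = y"
proof -
  have "x ^ CARD('a) ^ m = (x - y) ^ CARD('a) ^ m + y ^ CARD('a) ^ m" using frobenius_add[of "x - y" y m] by simp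
  with assms show ?thesis by simp
qed

lemma frobenius_comp: "((x :: 'k) ^ CARD('a) ^ m) ^ CARD('a) ^ k = x ^ CARD('a) ^ (m + k)"
  by (simp add: power_add flip: power_mult)

lemma hom_frobenius: "hom a ^ CARD('a) ^ m = hom a"
proof (induction m)
  case (Suc m)
  have "hom a ^ CARD('a) ^ Suc m = (hom a ^ CARD('a) ^ m) ^ CARD('a)"
    by (simp flip: power_mult add: mult.commute)
  also have "\<dots> = hom (a ^ CARD('a))" by (simp add: Suc hom_power)
  finally show ?case by (simp only: finite_field_power_card)
qed simp

lemma eval_frobenius: "eval g (x ^ CARD('a) ^ m) = eval g x ^ CARD('a) ^ m"
  by (induction g) (simp_all add: hom_frobenius frobenius_add power_mult_distrib)

lemma card_frobenius_fixed:
  assumes "m \<ge> 1"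
  shows "finite {x :: 'k. x ^ CARD('a) ^ m = x}" and "card {x :: 'k. x ^ CARD('a) ^ m = x} \<le> CARD('a) ^ m"
proof -
  define p :: "'k poly" where "p = monom 1 (CARD('a) ^ m) - monom 1 1"
  have qm: "1 < CARD('a) ^ m" using assms two_le_CARD_field[where 'a='a] by (intro one_less_power) auto
  then have "coeff p (CARD('a) ^ m) = 1" by (simp add: p_def)
  then have "p \<noteq> 0" by auto
  moreover have "degree p \<le> CARD('a) ^ m"
    unfolding p_def using qm by (intro degree_diff_le) (auto intro: order_trans[OF degree_monom_le])
  moreover have "{x :: 'k. x ^ CARD('a) ^ m = x} = {x. poly p x = 0}" by (simp add: p_def poly_monom)
  ultimately show "finite {x :: 'k. x ^ CARD('a) ^ m = x}" "card {x :: 'k. x ^ CARD('a) ^ m = x} \<le> CARD('a) ^ m"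
    using poly_roots_finite[of p] card_poly_roots_bound[of p] by simp_all
qed

text \<open>Division with remainder by \<open>m\<close>, a nonzero polynomial of least degree
  vanishing at \<open>a\<close>, shows that \<open>m\<close> divides all polynomials vanishing
  there. Being a divisor of the irreducible \<open>p\<close> and no unit, \<open>m\<close> is
  divisible by \<open>p\<close> in turn.\<close>

lemma irreducible_dvd_of_common_root:
  assumes p: "irreducible p" "eval p a = 0" and g: "eval g a = 0"
  shows "p dvd g"
proof -
  have "p \<noteq> 0" using p by auto
  then obtain m where m: "m \<noteq> 0" "eval m a = 0"
    and min: "\<And>h. h \<noteq> 0 \<Longrightarrow> eval h a = 0 \<Longrightarrow> degree m \<le> degree h"
    using ex_has_least_nat[of "\<lambda>h. h \<noteq> 0 \<and> eval h a = 0" p degree] p by blast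
  have dvd: "m dvd h" if "eval h a = 0" for h
  proof -
    have "eval (h mod m) a = eval (h - h div m * m) a" by (simp only: minus_div_mult_eq_mod)
    then have "eval (h mod m) a = 0" unfolding eval_simps using that m by simp
    then have "h mod m = 0" using min[of "h mod m"] degree_mod_less[of m h] m by force
    then show ?thesis by auto
  qed
  obtain s where s: "p = m * s" using dvd[OF p(2)] by blast
  have "\<not> m dvd 1"
  proof
    assume "m dvd 1"
    then have "degree m = 0" using m(1) by (simp add: is_unit_iff_degree)
    then obtain c where "m = [:c:]" by (rule degree_eq_zeroE)
    then show False using m by simp
  qed
  then have "s dvd 1" using Factorial_Ring.irreducibleD[OF p(1) s] by blast
  then have "p dvd m" using s by (simp add: mult_unit_dvd_iff)
  then show ?thesis by (rule dvd_trans) (rule dvd[OF g])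
qed

lemma eval_inj_on_polys_below:
  assumes p: "irreducible p" "eval p a = 0"
  shows "inj_on (\<lambda>g. eval g a) (polys_below (degree p))"
proof (rule inj_onI)
  fix g h assume gh: "g \<in> polys_below (degree p)" "h \<in> polys_below (degree p)" "eval g a = eval h a"
  have "p dvd g - h" using gh by (intro irreducible_dvd_of_common_root[OF p]) simp
  moreover have "coeff (g - h) i = 0" if "i \<ge> degree p" for i using gh that by (simp add: polys_below_def)
  ultimately have "lead_coeff (g - h) = 0" if "g - h \<noteq> 0" using dvd_imp_degree_le that by blast
  then have "g - h = 0" unfolding leading_coeff_0_iff by blast
  then show "g = h" by simp
qed

text \<open>If \<open>a\<close> is fixed by the \<open>r\<close>-th power of the Frobenius map, so are the \<open>q ^ degree p\<close> values at \<open>a\<close>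
  of polynomials of smaller degree than \<open>p\<close>, but there are at most \<open>q ^ r\<close> fixed points.\<close>

lemma frobenius_period_ge:
  assumes p: "irreducible p" "eval p a = 0" and r: "r \<ge> 1" "a ^ CARD('a) ^ r = a"
  shows "degree p \<le> r"
proof -
  have "(\<lambda>g. eval g a) ` polys_below (degree p) \<subseteq> {x. x ^ CARD('a) ^ r = x}"
    using r by (auto simp flip: eval_frobenius)
  then have "card ((\<lambda>g. eval g a) ` polys_below (degree p)) \<le> card {x :: 'k. x ^ CARD('a) ^ r = x}"
    by (intro card_mono card_frobenius_fixed(1)[OF r(1)])
  then have "CARD('a) ^ degree p \<le> card {x :: 'k. x ^ CARD('a) ^ r = x}"
    by (simp add: card_image[OF eval_inj_on_polys_below[OF p]] card_polys_below)
  also have "\<dots> \<le> CARD('a) ^ r" by (rule card_frobenius_fixed(2)[OF r(1)])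
  finally show ?thesis using two_le_CARD_field[where 'a='a] by (simp add: power_increasing_iff)
qed

lemma conjugates_distinct:
  assumes p: "irreducible p" "eval p a = 0"
  shows "inj_on (\<lambda>i. a ^ CARD('a) ^ i) {..<degree p}"
proof -
  have "i = k" if "i \<le> k" "k < degree p" "a ^ CARD('a) ^ i = a ^ CARD('a) ^ k" for i k
  proof (rule ccontr)
    assume "i \<noteq> k"
    have "a ^ CARD('a) ^ k = (a ^ CARD('a) ^ (k - i)) ^ CARD('a) ^ i" using that by (simp only: frobenius_comp) simp
    then have "a ^ CARD('a) ^ (k - i) = a" using that frobenius_inj by metis
    moreover have "1 \<le> k - i" using that \<open>i \<noteq> k\<close> by simp
    ultimately have "degree p \<le> k - i" using frobenius_period_ge[OF p] by blast
    then show False using that \<open>1 \<le> k - i\<close> by simp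
  qed
  then show ?thesis by (intro inj_onI) (metis lessThan_iff nle_le)
qed

lemma eval_conjugate_root: "eval p a = 0 \<Longrightarrow> eval p (a ^ CARD('a) ^ i) = 0"
  by (simp add: eval_frobenius zero_power)

text \<open>The conjugates with index at most \<open>D\<close> are roots of a polynomial of degree
  \<open>D\<close>, so two of them coincide. Their index difference is a period of at most
  \<open>D\<close>, and \<open>frobenius_period_ge\<close> leaves only \<open>D\<close>.\<close>

lemma frobenius_period:
  assumes p: "irreducible p" "eval p a = 0"
  shows "a ^ CARD('a) ^ degree p = a"
proof -
  define D where "D = degree p"
  have p0: "map_poly hom p \<noteq> 0" using p by auto
  have "\<not> inj_on (\<lambda>i. a ^ CARD('a) ^ i) {..D}"
  proof
    assume "inj_on (\<lambda>i. a ^ CARD('a) ^ i) {..D}"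
    then have "card {..D} \<le> card {x. poly (map_poly hom p) x = 0}"
      using eval_conjugate_root[OF p(2)] poly_roots_finite[OF p0]
      by (intro card_inj_on_le[of "\<lambda>i. a ^ CARD('a) ^ i"]) (auto simp: eval_def)
    then show False using card_poly_roots_bound[OF p0] by (simp add: D_def)
  qed
  then obtain i k where ik: "i < k" "k \<le> D" "a ^ CARD('a) ^ i = a ^ CARD('a) ^ k"
    unfolding inj_on_def by (metis (no_types, lifting) atMost_iff linorder_neqE_nat)
  have "a ^ CARD('a) ^ k = (a ^ CARD('a) ^ (k - i)) ^ CARD('a) ^ i" using ik by (simp only: frobenius_comp) simp
  then have *: "a ^ CARD('a) ^ (k - i) = a" using ik frobenius_inj by metis
  then have "D \<le> k - i" unfolding D_def using ik by (intro frobenius_period_ge[OF p]) auto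
  then have "k - i = D" using ik by simp
  with * show ?thesis by (simp add: D_def)
qed

lemma frobenius_period_mult:
  assumes "a ^ CARD('a) ^ m = (a :: 'k)"
  shows "a ^ CARD('a) ^ (m * k) = a"
proof (induction k)
  case (Suc k)
  have "a ^ CARD('a) ^ (m * Suc k) = (a ^ CARD('a) ^ (m * k)) ^ CARD('a) ^ m" by (simp add: frobenius_comp add.commute)
  with Suc assms show ?case by simp
qed simp

text \<open>Two monic polynomials of degree \<open>degree p\<close> that agree at as many distinct
  points, here the conjugates of \<open>a\<close>, are equal.\<close>

lemma map_poly_eq_prod_conjugates:
  assumes p: "irreducible p" "eval p a = 0" "lead_coeff p = 1"
  shows "map_poly hom p = (\<Prod>i<degree p. [:- (a ^ CARD('a) ^ i), 1:])"
proof (rule poly_eqI_degree_lead_coeff[of _ "degree p" _ "(\<lambda>i. a ^ CARD('a) ^ i) ` {..<degree p}"])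
  have m: "monic (\<Prod>i<degree p. [:- (a ^ CARD('a) ^ i), 1:])" by (intro monic_prod) auto
  have d: "degree (\<Prod>i<degree p. [:- (a ^ CARD('a) ^ i), 1:]) = degree p"
    by (subst degree_prod_eq_sum_degree) auto
  show "coeff (map_poly hom p) (degree p) = coeff (\<Prod>i<degree p. [:- (a ^ CARD('a) ^ i), 1:]) (degree p)"
    using m d p(3) by simp
  show "degree p \<le> card ((\<lambda>i. a ^ CARD('a) ^ i) ` {..<degree p})"
    using conjugates_distinct[OF p(1,2)] by (simp add: card_image)
  show "degree (\<Prod>i<degree p. [:- (a ^ CARD('a) ^ i), 1:]) \<le> degree p" using d by simp
  fix z assume "z \<in> (\<lambda>i. a ^ CARD('a) ^ i) ` {..<degree p}"
  then obtain i where i: "i < degree p" "z = a ^ CARD('a) ^ i" by blast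
  show "poly (map_poly hom p) z = poly (\<Prod>i<degree p. [:- (a ^ CARD('a) ^ i), 1:]) z"
    using eval_conjugate_root[OF p(2), of i] i by (auto simp: eval_def poly_prod intro!: exI[of _ i])
qed simp

lemma roots_eq_conjugates:
  assumes p: "irreducible p" "eval p a = 0" "lead_coeff p = 1"
  shows "{x. eval p x = 0} = (\<lambda>i. a ^ CARD('a) ^ i) ` {..<degree p}"
  using map_poly_eq_prod_conjugates[OF p] by (auto simp: eval_def poly_prod)

text \<open>The conjugates repeat with period \<open>degree p\<close>, so
  \<open>degree p * e\<close> consecutive ones run through the roots \<open>e\<close> times. Apart
  from \<open>a\<close>, the product depends only on \<open>degree p * e\<close>, which gives all
  prime powers of one degree the same formula.\<close>

lemma eval_power_eq_prod_conjugates: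
  assumes p: "irreducible p" "eval p a = 0" "lead_coeff p = 1"
  shows "eval (p ^ e) x = (\<Prod>i<degree p * e. x - a ^ CARD('a) ^ i)"
proof -
  have 1: "eval p x = (\<Prod>i<degree p. x - a ^ CARD('a) ^ i)"
    unfolding eval_def map_poly_eq_prod_conjugates[OF p] by (simp add: poly_prod)
  have "(\<Prod>i<degree p * e. x - a ^ CARD('a) ^ i) = (\<Prod>k<e. \<Prod>i\<in>{k * degree p..<k * degree p + degree p}. x - a ^ CARD('a) ^ i)"
    by (simp add: prod.nat_group mult.commute)
  also have "\<dots> = (\<Prod>k<e. eval p x)"
  proof (intro prod.cong refl)
    fix k
    have "(\<Prod>i\<in>{k * degree p..<k * degree p + degree p}. x - a ^ CARD('a) ^ i)
        = (\<Prod>i<degree p. x - a ^ CARD('a) ^ (k * degree p + i))"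
      by (rule prod.reindex_bij_witness[of _ "\<lambda>i. k * degree p + i" "\<lambda>i. i - k * degree p"]) auto
    also have "\<dots> = (\<Prod>i<degree p. x - a ^ CARD('a) ^ i)"
    proof (rule prod.cong[OF refl])
      fix i
      have "a ^ CARD('a) ^ (k * degree p) = a"
        using frobenius_period_mult[OF frobenius_period[OF p(1,2)], of k] by (simp add: mult.commute)
      then show "x - a ^ CARD('a) ^ (k * degree p + i) = x - a ^ CARD('a) ^ i"
        by (simp flip: frobenius_comp)
    qed
    finally show "(\<Prod>i\<in>{k * degree p..<k * degree p + degree p}. x - a ^ CARD('a) ^ i) = eval p x"
      using 1 by simp
  qed
  finally show ?thesis by simp
qed

end

text \<open>The pair is kept instead of \<open>p ^ e\<close> to have the weight
  \<open>degree p\<close>, the analogue of the von Mangoldt function, at hand.\<close>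

definition prime_powers :: "nat \<Rightarrow> ('a::field poly \<times> nat) set" where
  "prime_powers N = {(p, e). irreducible p \<and> lead_coeff p = 1 \<and> e \<ge> 1 \<and> degree p * e = N}"

lemma irreducible_degree_pos: "irreducible (p :: 'a::field poly) \<Longrightarrow> degree p > 0"
  using irreducible_not_unit[of p] is_unit_iff_degree[of p] by (cases "p = 0") auto

lemma finite_prime_powers: "finite (prime_powers N :: ('a::{field,finite} poly \<times> nat) set)"
proof (rule finite_subset)
  show "prime_powers N \<subseteq> (polys_below (Suc N) :: 'a poly set) \<times> {..N}"
  proof
    fix x :: "'a poly \<times> nat" assume "x \<in> prime_powers N"
    then obtain p e where pe: "x = (p, e)" "(p, e) \<in> prime_powers N" by (cases x) auto
    then have D: "irreducible p" "e \<ge> 1" "degree p * e = N" by (auto simp: prime_powers_def)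
    then have "degree p \<le> N" "e \<le> N"
      using irreducible_degree_pos[of p] by (auto simp flip: D(3))
    then show "x \<in> polys_below (Suc N) \<times> {..N}"
      unfolding pe(1) by (auto simp: polys_below_def intro: coeff_eq_0)
  qed
  show "finite (polys_below (Suc N) \<times> {..N} :: ('a poly \<times> nat) set)"
    by (simp add: finite_polys_below)
qed

text \<open>The weight \<open>degree p\<close> counts the roots of \<open>p\<close>, and distinct
  pairs have disjoint root sets. So it suffices that \<open>Y\<close> contains these roots; the last
  premise offers the facts about a root on which membership can rest.\<close>

lemma sum_degree_prime_powers_le:
  fixes hom :: "'a::{field,finite} \<Rightarrow> 'k::alg_closed_field"
  assumes hom: "finite_field_hom hom" and U: "U \<subseteq> prime_powers N" and fin: "finite Y"
    and Y: "\<And>p e a. (p, e) \<in> U \<Longrightarrow> finite_field_hom.eval hom p a = 0 \<Longrightarrow> a ^ CARD('a) ^ N = a \<Longrightarrow>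
      (\<And>x. finite_field_hom.eval hom (p ^ e) x = (\<Prod>i<N. x - a ^ CARD('a) ^ i)) \<Longrightarrow> a \<in> Y"
  shows "(\<Sum>(p, e)\<in>U. degree p) \<le> card Y"
proof -
  interpret finite_field_hom hom by (rule hom)
  define roots where "roots = (\<lambda>(p, e :: nat). {x. eval p x = 0})"
  have U': "irreducible p" "lead_coeff p = 1" "e \<ge> 1" "degree p * e = N" "degree p > 0" if "(p, e) \<in> U" for p e
    using that U irreducible_degree_pos by (auto simp: prime_powers_def)
  have conj: "\<exists>a. eval p a = 0" if "(p, e) \<in> U" for p e
    using alg_closed_imp_poly_has_root[of "map_poly hom p"] U'[OF that] by (auto simp: eval_def)
  have card: "card (roots k) = degree (fst k)" "finite (roots k)" if "k \<in> U" for k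
  proof -
    obtain p e where k: "k = (p, e)" by (cases k)
    have "(p, e) \<in> U" using that k by simp
    then obtain a where a: "eval p a = 0" using conj by blast
    show "card (roots k) = degree (fst k)" "finite (roots k)"
      using roots_eq_conjugates[of p a] conjugates_distinct[of p a] U'[of p e] that a
      by (auto simp: roots_def k card_image)
  qed
  have disj: "roots k \<inter> roots k' = {}" if k: "k \<in> U" "k' \<in> U" "k \<noteq> k'" for k k'
  proof (rule ccontr)
    assume "roots k \<inter> roots k' \<noteq> {}"
    obtain p e p' e' where kk: "k = (p, e)" "k' = (p', e')" by (metis surj_pair)
    then obtain a where a: "eval p a = 0" "eval p' a = 0"
      using \<open>roots k \<inter> roots k' \<noteq> {}\<close> by (auto simp: roots_def)
    have pe: "(p, e) \<in> U" "(p', e') \<in> U" using k kk by simp_all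
    have "p dvd p'" "p' dvd p"
      using irreducible_dvd_of_common_root[of p a p'] irreducible_dvd_of_common_root[of p' a p]
        a U'(1)[OF pe(1)] U'(1)[OF pe(2)] by simp_all
    then have eq: "p = p'" using U'(2)[OF pe(1)] U'(2)[OF pe(2)] by (intro poly_dvd_antisym) simp_all
    \<comment> \<open>Both pairs satisfy \<open>degree p * e = N\<close>, so the base determines the
      exponent.\<close>
    moreover have "e = e'"
      using U'(4)[OF pe(1)] U'(4)[OF pe(2)] U'(5)[OF pe(1)] unfolding eq by auto
    ultimately show False using k kk by simp
  qed
  have "finite U" using finite_subset[OF U finite_prime_powers] .
  have "(\<Sum>(p, e)\<in>U. degree p) = (\<Sum>k\<in>U. card (roots k))"
    by (intro sum.cong) (auto simp: card)
  also have "\<dots> = card (\<Union>k\<in>U. roots k)"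
    using \<open>finite U\<close> card disj by (subst card_UN_disjoint) auto
  also have "\<dots> \<le> card Y"
  proof (intro card_mono fin UN_least subsetI)
    fix k a assume "k \<in> U" "a \<in> roots k"
    then obtain p e where k: "(p, e) \<in> U" "eval p a = 0" by (auto simp: roots_def)
    show "a \<in> Y"
      using Y[OF k] frobenius_period_mult[OF frobenius_period[of p a], of e]
        eval_power_eq_prod_conjugates[of p a e] U'[OF k(1)] k(2) by auto
  qed
  finally show ?thesis .
qed

section \<open>Character sums over monic polynomials\<close>

definition monic_polys :: "nat \<Rightarrow> 'a::field poly set" where
  "monic_polys k = {g. lead_coeff g = 1 \<and> degree g = k}"

lemma bij_betw_monic_polys:
  "bij_betw (\<lambda>g. monom 1 k + g) (polys_below k) (monic_polys k :: 'a::field poly set)"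
proof (rule bij_betw_byWitness[where f' = "\<lambda>g. g - monom 1 k"])
  show "(\<lambda>g. monom 1 k + g) ` polys_below k \<subseteq> (monic_polys k :: 'a poly set)"
  proof safe
    fix g :: "'a poly" assume "g \<in> polys_below k"
    then have g: "coeff g i = 0" if "i \<ge> k" for i using that by (simp add: polys_below_def)
    have "degree (monom 1 k + g) = k"
      using g by (intro antisym degree_le le_degree) auto
    then show "monom 1 k + g \<in> monic_polys k" using g by (simp add: monic_polys_def)
  qed
  show "(\<lambda>g. g - monom 1 k) ` monic_polys k \<subseteq> (polys_below k :: 'a poly set)"
    by (auto simp: monic_polys_def polys_below_def coeff_eq_0)
qed auto

lemma finite_monic_polys: "finite (monic_polys k :: 'a::{field,finite} poly set)"
  using bij_betw_finite[OF bij_betw_monic_polys[of k, where 'a='a]] by (simp add: finite_polys_below)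

lemma card_monic_polys: "card (monic_polys k :: 'a::{field,finite} poly set) = CARD('a) ^ k"
  using bij_betw_same_card[OF bij_betw_monic_polys[of k, where 'a='a]] by (simp add: card_polys_below)

section \<open>Unique factorisation into monic irreducibles\<close>

lemma ex_monic_irreducible_factor:
  fixes g :: "'a::field poly"
  assumes "degree g > 0"
  shows "\<exists>p. irreducible p \<and> lead_coeff p = 1 \<and> p dvd g"
proof -
  have "\<exists>p. (p dvd g \<and> degree p > 0) \<and> (\<forall>h. h dvd g \<and> degree h > 0 \<longrightarrow> degree p \<le> degree h)"
    by (rule ex_has_least_nat[of _ g]) (use assms in simp)
  then obtain p where p: "p dvd g" "degree p > 0"
    and min: "\<And>h. h dvd g \<Longrightarrow> degree h > 0 \<Longrightarrow> degree p \<le> degree h"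
    by blast
  define r where "r = smult (1 / lead_coeff p) p"
  have p0: "p \<noteq> 0" using p by auto
  have "r dvd p" using p0 unfolding r_def by (simp add: smult_dvd_iff)
  then have rg: "r dvd g" using p(1) by (rule dvd_trans)
  have "irreducible r"
  proof (rule Factorial_Ring.irreducibleI)
    show "r \<noteq> 0" using p0 by (simp add: r_def)
    show "\<not> r dvd 1" using p p0 by (simp add: r_def is_unit_iff_degree)
    fix a b assume ab: "r = a * b"
    then have "a \<noteq> 0" "b \<noteq> 0" using \<open>r \<noteq> 0\<close> by auto
    then have deg: "degree a + degree b = degree p"
      using degree_mult_eq[of a b] p0 unfolding ab[symmetric] by (simp add: r_def)
    have "a dvd g" using rg unfolding ab by (rule dvd_mult_left)
    moreover have "b dvd g" using rg unfolding ab by (rule dvd_mult_right)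
    ultimately have "degree a = 0 \<or> degree b = 0" using min[of a] min[of b] deg by linarith
    then show "a dvd 1 \<or> b dvd 1" using \<open>a \<noteq> 0\<close> \<open>b \<noteq> 0\<close> by (auto simp: is_unit_iff_degree)
  qed
  moreover have "lead_coeff r = 1" using p0 by (simp add: r_def)
  ultimately show ?thesis using rg by blast
qed

lemma monic_irreducible_dvd_imp_eq:
  fixes p r :: "'a::field poly"
  assumes "irreducible p" "lead_coeff p = 1" "irreducible r" "lead_coeff r = 1" "p dvd r"
  shows "p = r"
proof -
  obtain s where s: "r = p * s" using assms by blast
  have "\<not> p dvd 1" by (rule irreducible_not_unit[OF assms(1)])
  then have "s dvd 1" using Factorial_Ring.irreducibleD[OF assms(3) s] by blast
  then have "r dvd p" using s by (simp add: mult_unit_dvd_iff)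
  then show ?thesis using assms by (metis poly_dvd_antisym)
qed

lemma irreducible_power_dvd_mult:
  fixes p r h :: "'a::field poly"
  assumes p: "irreducible p" and r: "\<not> p dvd r" and "p ^ e dvd r * h"
  shows "p ^ e dvd h"
  using assms(3)
proof (induction e)
  case (Suc e)
  have "p ^ e dvd r * h" using Suc.prems by (metis dvd_mult_right power_Suc)
  then obtain s where s: "h = p ^ e * s" using Suc.IH by blast
  have "p ^ e * p dvd p ^ e * (r * s)" using Suc.prems s by (simp add: ac_simps)
  moreover have "p ^ e \<noteq> 0" using p by auto
  ultimately have "p dvd r * s" by (metis dvd_mult_cancel_left)
  then have "p dvd s" using field_poly_irreducible_imp_prime[OF p] r by (simp add: prime_elem_dvd_mult_iff)
  then show ?case using s by (simp add: mult_dvd_mono mult.commute)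
qed simp

text \<open>For nonzero \<open>g\<close>, an irreducible factor of multiplicity \<open>m\<close>
  contributes the \<open>m\<close> pairs with \<open>e = 1, ..., m\<close>, so a sum over this set
  counts multiplicities without naming them.\<close>

definition prime_power_divisors :: "'a::field poly \<Rightarrow> ('a poly \<times> nat) set" where
  "prime_power_divisors g = {(p, e). irreducible p \<and> lead_coeff p = 1 \<and> e \<ge> 1 \<and> p ^ e dvd g}"

text \<open>One more factor \<open>r\<close> raises the multiplicity of \<open>r\<close> by one: the
  exponents at \<open>r\<close> move up and \<open>(r, 1)\<close> fills the gap. The others stay,
  since irreducibles are prime.\<close>

lemma prime_power_divisors_mult:
  fixes r h :: "'a::field poly"
  assumes r: "irreducible r" "lead_coeff r = 1"
  shows "prime_power_divisors (r * h) =
    insert (r, 1) ((\<lambda>(p, e). if p = r then (p, e + 1) else (p, e)) ` prime_power_divisors h)"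
    (is "_ = insert _ (?f ` _)")
proof (intro equalityI subsetI)
  fix x assume "x \<in> prime_power_divisors (r * h)"
  then obtain p e where x: "x = (p, e)" "irreducible p" "lead_coeff p = 1" "e \<ge> 1" "p ^ e dvd r * h"
    by (auto simp: prime_power_divisors_def)
  show "x \<in> insert (r, 1) (?f ` prime_power_divisors h)"
  proof (cases "p = r")
    case False
    then have "\<not> p dvd r" using monic_irreducible_dvd_imp_eq x r by blast
    then have "p ^ e dvd h" using irreducible_power_dvd_mult x by blast
    then have "(p, e) \<in> prime_power_divisors h" using x by (simp add: prime_power_divisors_def)
    then have "?f (p, e) \<in> ?f ` prime_power_divisors h" by (rule imageI)
    then show ?thesis using False x by simp
  next
    case True
    obtain e' where e': "e = Suc e'" using x by (cases e) auto
    show ?thesis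
    proof (cases "e' = 0")
      case False
      have "r \<noteq> 0" using r by auto
      then have "r ^ e' dvd h" using x True e' by simp
      then have "(r, e') \<in> prime_power_divisors h" using r False by (simp add: prime_power_divisors_def)
      then have "?f (r, e') \<in> ?f ` prime_power_divisors h" by (rule imageI)
      then show ?thesis using True x e' by simp
    qed (use True x e' in simp)
  qed
next
  fix x assume "x \<in> insert (r, 1) (?f ` prime_power_divisors h)"
  then show "x \<in> prime_power_divisors (r * h)"
    using r by (auto simp: prime_power_divisors_def mult_dvd_mono split: if_splits)
qed

text \<open>The analogue of \<open>log n\<close> as the sum of the von Mangoldt function over the
  divisors of \<open>n\<close>. Splitting off one irreducible factor \<open>r\<close> removes the
  weight of \<open>(r, 1)\<close>, and the shift of exponents preserves the other weights.\<close>

lemma sum_degree_prime_power_divisors: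
  fixes g :: "'a::field poly"
  assumes "lead_coeff g = 1"
  shows "finite (prime_power_divisors g) \<and> (\<Sum>(p, e)\<in>prime_power_divisors g. degree p) = degree g"
  using assms
proof (induction "degree g" arbitrary: g rule: less_induct)
  case less
  show ?case
  proof (cases "degree g = 0")
    case True
    then have "g = 1" using less.prems by (metis degree_eq_zeroE lead_coeff_pCons(2) one_pCons coeff_pCons_0 degree_pCons_0)
    moreover have "\<not> p ^ e dvd 1" if "irreducible p" "e \<ge> 1" for p :: "'a poly" and e
    proof
      assume "p ^ e dvd 1"
      moreover have "p dvd p ^ e" using that(2) by (intro dvd_power) simp
      ultimately have "p dvd 1" by (rule dvd_trans[rotated])
      then show False using irreducible_not_unit[OF that(1)] by contradiction
    qed
    ultimately have "prime_power_divisors g = {}" by (auto simp: prime_power_divisors_def)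
    then show ?thesis using True by simp
  next
    case False
    then obtain r where r: "irreducible r" "lead_coeff r = 1" "r dvd g"
      using ex_monic_irreducible_factor[of g] by blast
    then obtain h where h: "g = r * h" by blast
    have "g \<noteq> 0" using False by auto
    then have deg: "degree g = degree r + degree h" using h by (auto simp: degree_mult_eq)
    have lh: "lead_coeff h = 1" using less.prems r h by (simp add: lead_coeff_mult)
    let ?f = "\<lambda>(p, e :: nat). if p = r then (p, e + 1) else (p, e)"
    have IH: "finite (prime_power_divisors h)" "(\<Sum>(p, e)\<in>prime_power_divisors h. degree p) = degree h"
      using less.hyps[of h] deg irreducible_degree_pos[OF r(1)] lh by auto
    have inj: "inj_on ?f (prime_power_divisors h)"
      by (auto simp: inj_on_def split: if_splits)
    have notin: "(r, 1) \<notin> ?f ` prime_power_divisors h"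
      by (auto simp: prime_power_divisors_def split: if_splits)
    have "(\<Sum>(p, e)\<in>prime_power_divisors g. degree p)
        = degree r + (\<Sum>(p, e)\<in>?f ` prime_power_divisors h. degree p)"
      unfolding h prime_power_divisors_mult[OF r(1,2)] using IH(1) notin by (subst sum.insert) auto
    also have "(\<Sum>(p, e)\<in>?f ` prime_power_divisors h. degree p) = (\<Sum>(p, e)\<in>prime_power_divisors h. degree p)"
      by (subst sum.reindex[OF inj]) (auto intro!: sum.cong split: if_splits)
    finally show ?thesis
      using IH deg unfolding h prime_power_divisors_mult[OF r(1,2)] by simp
  qed
qed

lemma degree_eq_sum_prime_powers:
  fixes g :: "'a::{field,finite} poly"
  assumes "g \<in> monic_polys k"
  shows "k = (\<Sum>N=1..k. \<Sum>(p, e)\<in>prime_powers N. if p ^ e dvd g then degree p else 0)"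
proof -
  have g: "lead_coeff g = 1" "degree g = k" "g \<noteq> 0" using assms by (auto simp: monic_polys_def)
  have eq: "prime_power_divisors g = (\<Union>N\<in>{1..k}. {(p, e)\<in>prime_powers N. p ^ e dvd g})"
  proof (intro equalityI subsetI)
    fix x assume "x \<in> prime_power_divisors g"
    then obtain p e where x: "x = (p, e)" "irreducible p" "lead_coeff p = 1" "e \<ge> 1" "p ^ e dvd g"
      by (auto simp: prime_power_divisors_def)
    have "p \<noteq> 0" using x(2) by auto
    then have "degree p * e \<le> k"
      using dvd_imp_degree_le[OF x(5)] g by (simp add: degree_power_eq x mult.commute)
    moreover have "degree p * e \<ge> 1" using irreducible_degree_pos x by (simp add: Suc_le_eq)
    ultimately show "x \<in> (\<Union>N\<in>{1..k}. {(p, e)\<in>prime_powers N. p ^ e dvd g})"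
      using x by (auto simp: prime_powers_def)
  qed (auto simp: prime_powers_def prime_power_divisors_def)
  have "k = (\<Sum>(p, e)\<in>prime_power_divisors g. degree p)"
    using sum_degree_prime_power_divisors[OF g(1)] g(2) by simp
  also have "\<dots> = (\<Sum>N=1..k. \<Sum>(p, e)\<in>{(p, e)\<in>prime_powers N. p ^ e dvd g}. degree p)"
    unfolding eq
    by (intro sum.UNION_disjoint) (auto simp: prime_powers_def intro: finite_subset[OF _ finite_prime_powers])
  also have "\<dots> = (\<Sum>N=1..k. \<Sum>(p, e)\<in>prime_powers N. if p ^ e dvd g then degree p else 0)"
  proof (rule sum.cong[OF refl])
    fix N
    have "{(p, e)\<in>prime_powers N. p ^ e dvd g} = {x \<in> prime_powers N. fst x ^ snd x dvd g}" by auto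
    then show "(\<Sum>(p, e)\<in>{(p, e)\<in>prime_powers N. p ^ e dvd g}. degree p)
        = (\<Sum>(p, e)\<in>prime_powers N. if p ^ e dvd g then degree p else 0)"
      using finite_prime_powers[of N, where 'a='a] by (simp add: sum.inter_filter case_prod_unfold)
  qed
  finally show ?thesis .
qed

section \<open>Coefficients of the L-function and of its logarithmic derivative\<close>

definition char_sum :: "('a::field poly \<Rightarrow> complex) \<Rightarrow> nat \<Rightarrow> complex" where
  "char_sum \<phi> k = (\<Sum>g\<in>monic_polys k. \<phi> g)"

definition prime_power_sum :: "('a::field poly \<Rightarrow> complex) \<Rightarrow> nat \<Rightarrow> complex" where
  "prime_power_sum \<phi> N = (\<Sum>(p, e)\<in>prime_powers N. of_nat (degree p) * \<phi> (p ^ e))"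

text \<open>Write the degree \<open>k\<close> of \<open>g\<close> as the sum of
  \<open>degree p\<close> over the prime powers dividing \<open>g\<close>, and exchange the sums: a
  monic \<open>g\<close> divisible by \<open>p ^ e\<close> is \<open>p ^ e * h\<close> with
  \<open>h\<close> monic of degree \<open>k - N\<close>, and \<open>\<phi> (p ^ e)\<close> splits
  off.\<close>

lemma char_sum_recursion:
  fixes \<phi> :: "'a::{field,finite} poly \<Rightarrow> complex"
  assumes mult: "\<And>g h. \<phi> (g * h) = \<phi> g * \<phi> h"
  shows "of_nat k * char_sum \<phi> k = (\<Sum>N=1..k. prime_power_sum \<phi> N * char_sum \<phi> (k - N))"
proof -
  have inner: "(\<Sum>g\<in>monic_polys k. if p ^ e dvd g then \<phi> g else 0) = \<phi> (p ^ e) * char_sum \<phi> (k - N)"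
    if pe: "(p, e) \<in> prime_powers N" and N: "N \<in> {1..k}" for p :: "'a poly" and e N
  proof -
    have p: "lead_coeff p = 1" "degree p * e = N" "p \<noteq> 0" using pe by (auto simp: prime_powers_def)
    have d: "degree (p ^ e) = N" "lead_coeff (p ^ e) = 1" "p ^ e \<noteq> 0"
    proof -
      show "degree (p ^ e) = N" using p by (simp add: degree_power_eq mult.commute)
      show "lead_coeff (p ^ e) = 1" using p(1) by (simp only: lead_coeff_power power_one)
      show "p ^ e \<noteq> 0" using p(3) by simp
    qed
    have eq: "{g \<in> monic_polys k. p ^ e dvd g} = (\<lambda>h. p ^ e * h) ` monic_polys (k - N)"
    proof (intro equalityI subsetI)
      fix g assume g: "g \<in> {g \<in> monic_polys k. p ^ e dvd g}"
      then obtain h where h: "g = p ^ e * h" by blast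
      have "g \<noteq> 0" "lead_coeff g = 1" "degree g = k" using g by (auto simp: monic_polys_def)
      have "h \<noteq> 0" using \<open>g \<noteq> 0\<close> h by auto
      have "lead_coeff g = lead_coeff (p ^ e) * lead_coeff h" unfolding h by (rule lead_coeff_mult)
      then have "lead_coeff h = 1" unfolding d(2) \<open>lead_coeff g = 1\<close> by simp
      have "degree g = N + degree h" unfolding h degree_mult_eq[OF d(3) \<open>h \<noteq> 0\<close>] d(1) by (rule refl)
      then have "k = N + degree h" using \<open>degree g = k\<close> by simp
      with \<open>lead_coeff h = 1\<close> show "g \<in> (\<lambda>h. p ^ e * h) ` monic_polys (k - N)"
        using h by (intro image_eqI[of _ _ h]) (simp_all add: monic_polys_def)
    next
      fix g assume "g \<in> (\<lambda>h. p ^ e * h) ` monic_polys (k - N)"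
      then obtain h where gh: "g = p ^ e * h" and hm: "h \<in> monic_polys (k - N)" by (elim imageE)
      have h: "g = p ^ e * h" "lead_coeff h = 1" "degree h = k - N"
        using gh hm unfolding monic_polys_def by blast+
      then have "h \<noteq> 0" by auto
      have "degree g = N + degree h"
        unfolding h(1) degree_mult_eq[OF d(3) \<open>h \<noteq> 0\<close>] d(1) by (rule refl)
      then have "degree g = k" using h(3) N by simp
      have "lead_coeff g = 1" unfolding h(1) lead_coeff_mult d(2) h(2) by simp
      with \<open>degree g = k\<close> show "g \<in> {g \<in> monic_polys k. p ^ e dvd g}"
        using h(1) by (simp add: monic_polys_def)
    qed
    have "(\<Sum>g\<in>monic_polys k. if p ^ e dvd g then \<phi> g else 0) = (\<Sum>g\<in>{g \<in> monic_polys k. p ^ e dvd g}. \<phi> g)"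
      by (simp add: sum.inter_filter finite_monic_polys)
    also have "\<dots> = (\<Sum>h\<in>monic_polys (k - N). \<phi> (p ^ e) * \<phi> h)"
      unfolding eq using d(3) by (subst sum.reindex) (auto simp: inj_on_def mult)
    finally show ?thesis by (simp add: char_sum_def sum_distrib_left)
  qed
  have "of_nat k * char_sum \<phi> k = (\<Sum>g\<in>monic_polys k. of_nat k * \<phi> g)"
    by (simp add: char_sum_def sum_distrib_left)
  also have "\<dots> = (\<Sum>g\<in>monic_polys k. \<Sum>N=1..k. \<Sum>x\<in>prime_powers N.
      of_nat (degree (fst x)) * (if fst x ^ snd x dvd g then \<phi> g else 0))"
  proof (intro sum.cong refl)
    fix g :: "'a poly" assume g: "g \<in> monic_polys k"
    show "of_nat k * \<phi> g = (\<Sum>N=1..k. \<Sum>x\<in>prime_powers N.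
      of_nat (degree (fst x)) * (if fst x ^ snd x dvd g then \<phi> g else 0))"
      by (subst degree_eq_sum_prime_powers[OF g])
        (auto simp: sum_distrib_right case_prod_unfold intro!: sum.cong)
  qed
  also have "\<dots> = (\<Sum>N=1..k. \<Sum>x\<in>prime_powers N. \<Sum>g\<in>monic_polys k.
      of_nat (degree (fst x)) * (if fst x ^ snd x dvd g then \<phi> g else 0))"
    by (subst sum.swap, rule sum.cong[OF refl], rule sum.swap)
  also have "\<dots> = (\<Sum>N=1..k. \<Sum>x\<in>prime_powers N.
      of_nat (degree (fst x)) * \<phi> (fst x ^ snd x) * char_sum \<phi> (k - N))"
    by (intro sum.cong refl) (auto simp: inner mult.assoc simp flip: sum_distrib_left)
  also have "\<dots> = (\<Sum>N=1..k. prime_power_sum \<phi> N * char_sum \<phi> (k - N))"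
    by (simp add: prime_power_sum_def sum_distrib_right case_prod_unfold)
  finally show ?thesis .
qed

text \<open>The recursion for the trivial character has \<open>q ^ k\<close> as its sums over monic
  polynomials. By induction each of the \<open>N - 1\<close> earlier terms equals
  \<open>q ^ N\<close>, which leaves one copy for \<open>T N\<close>.\<close>

lemma sum_degree_prime_powers:
  assumes "N \<ge> 1"
  shows "(\<Sum>(p, e)\<in>(prime_powers N :: ('a::{field,finite} poly \<times> nat) set). degree p) = CARD('a) ^ N"
proof -
  define T where "T = prime_power_sum (\<lambda>_ :: 'a poly. 1)"
  define q :: complex where "q = of_nat CARD('a)"
  have c: "char_sum (\<lambda>_ :: 'a poly. 1) k = q ^ k" for k
    by (simp add: char_sum_def card_monic_polys q_def)
  have rec: "of_nat k * q ^ k = (\<Sum>N=1..k. T N * q ^ (k - N))" for k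
    using char_sum_recursion[of "\<lambda>_ :: 'a poly. 1" k] by (simp add: c T_def)
  have "T N = q ^ N"
    using assms
  proof (induction N rule: less_induct)
    case (less N)
    obtain M where N: "N = Suc M" using less.prems by (cases N) auto
    have "of_nat N * q ^ N = (\<Sum>i=1..M. T i * q ^ (N - i)) + T N"
      unfolding rec by (simp add: N)
    also have "(\<Sum>i=1..M. T i * q ^ (N - i)) = (\<Sum>i=1..M. q ^ N)"
      using less.IH N by (intro sum.cong refl) (auto simp flip: power_add)
    finally show ?case by (simp add: N algebra_simps)
  qed
  then have "of_nat (\<Sum>(p, e)\<in>(prime_powers N :: ('a poly \<times> nat) set). degree p) = (of_nat (CARD('a) ^ N) :: complex)"
    by (simp add: T_def prime_power_sum_def q_def case_prod_unfold)
  then show ?thesis by (simp only: of_nat_eq_iff)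
qed

text \<open>Averaging over translations by polynomials of degree less than \<open>n\<close>, whose values exhaust the
  extension field, turns each summand into a full character sum.\<close>

lemma char_sum_eq_0:
  fixes ev :: "'a::{field,finite} poly \<Rightarrow> 'b::{field,finite}"
  assumes add: "\<And>g h. ev (g + h) = ev g + ev h"
    and bij: "bij_betw ev (polys_below n) UNIV" and k: "k \<ge> n"
    and \<chi>: "(\<Sum>b\<in>UNIV. \<chi> b) = 0"
  shows "char_sum (\<lambda>g. \<chi> (ev g)) k = 0"
proof -
  have shift: "(\<Sum>g\<in>monic_polys k. \<chi> (ev (g + h))) = char_sum (\<lambda>g. \<chi> (ev g)) k"
    if h: "h \<in> polys_below n" for h
  proof -
    have "g + h \<in> monic_polys k \<longleftrightarrow> g \<in> monic_polys k" for g
    proof -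
      have "h \<in> polys_below k" using h k by (auto simp: polys_below_def)
      then have "g - monom 1 k \<in> polys_below k \<longleftrightarrow> g + h - monom 1 k \<in> polys_below k"
        by (auto simp: polys_below_def)
      moreover have "g \<in> monic_polys k \<longleftrightarrow> g - monom 1 k \<in> polys_below k" for g :: "'a poly"
        using bij_betw_imp_surj_on[OF bij_betw_monic_polys[of k, where 'a='a], symmetric]
        by (auto simp: image_iff intro!: bexI[of _ "g - monom 1 k"])
      ultimately show ?thesis by blast
    qed
    note iff = this
    show ?thesis
      unfolding char_sum_def
      by (rule sum.reindex_bij_witness[of _ "\<lambda>g. g - h" "\<lambda>g. g + h"])
        (use iff iff[of "_ - h"] in auto)
  qed
  have "of_nat (card (polys_below n :: 'a poly set)) * char_sum (\<lambda>g. \<chi> (ev g)) k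
      = (\<Sum>h\<in>polys_below n. \<Sum>g\<in>monic_polys k. \<chi> (ev (g + h)))"
    using shift by simp
  also have "\<dots> = (\<Sum>g\<in>monic_polys k. \<Sum>h\<in>polys_below n. \<chi> (ev g + ev h))"
    by (subst sum.swap) (simp add: add)
  also have "\<dots> = 0"
  proof (rule sum.neutral, rule ballI)
    fix g :: "'a poly"
    have "(\<Sum>h\<in>polys_below n. \<chi> (ev g + ev h)) = (\<Sum>b\<in>UNIV. \<chi> (ev g + b))"
      by (rule sum.reindex_bij_betw[OF bij])
    also have "\<dots> = (\<Sum>b\<in>UNIV. \<chi> b)"
      by (rule sum.reindex_bij_witness[of _ "\<lambda>b. b - ev g" "\<lambda>b. ev g + b"]) auto
    finally show "(\<Sum>h\<in>polys_below n. \<chi> (ev g + ev h)) = 0" using \<chi> by simp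
  qed
  finally show ?thesis using card_polys_below[of n, where 'a='a] by simp
qed

section \<open>The norm form and multiplicative characters\<close>

lemma sum_powers_nat: "x \<ge> 1 \<Longrightarrow> (\<Sum>k<m. x ^ k) * (x - 1) = x ^ m - (1::nat)"
proof (induction m)
  case (Suc m)
  have "x * x ^ m = (x - 1) * x ^ m + x ^ m" using Suc.prems by (cases x) auto
  moreover have "x ^ m \<ge> 1" using Suc.prems by simp
  ultimately show ?case using Suc by (simp add: algebra_simps)
qed simp

context finite_field_hom
begin

text \<open>The variable is \<open>x = a - a0\<close>, because \<open>stepanov_bound\<close> wants the simple root at \<open>0\<close>.\<close>

definition norm_form :: "'k \<Rightarrow> nat \<Rightarrow> 'k poly" where
  "norm_form a0 n = (\<Prod>r<n. [:a0 ^ CARD('a) ^ (n - r) - a0, -1:] ^ CARD('a) ^ r)"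

lemma degree_norm_form: "degree (norm_form a0 n) \<le> (\<Sum>r<n. CARD('a) ^ r)"
proof -
  have "degree (norm_form a0 n) \<le> (\<Sum>r<n. degree ([:a0 ^ CARD('a) ^ (n - r) - a0, -1:] ^ CARD('a) ^ r))"
    unfolding norm_form_def by (rule order_trans[OF degree_prod_sum_le]) auto
  also have "\<dots> \<le> (\<Sum>r<n. CARD('a) ^ r)"
    by (intro sum_mono order_trans[OF degree_power_le]) auto
  finally show ?thesis .
qed

text \<open>The factor at \<open>r = 0\<close> is \<open>-x\<close>, since the \<open>n\<close>-th
  Frobenius power fixes \<open>a0\<close>. The other factors do not vanish at \<open>0\<close>,
  since no smaller positive Frobenius power does.\<close>

lemma norm_form_simple_root:
  assumes f: "irreducible f" "eval f a0 = 0" "degree f = n"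
  shows "coeff (norm_form a0 n) 0 = 0" and "coeff (norm_form a0 n) 1 \<noteq> 0"
proof -
  define g where "g = (\<Prod>r\<in>{1..<n}. [:a0 ^ CARD('a) ^ (n - r) - a0, -1:] ^ CARD('a) ^ r)"
  have n: "n > 0" using irreducible_degree_pos f by blast
  have "{..<n} = insert 0 {1..<n}" using n by auto
  then have "norm_form a0 n = [:a0 ^ CARD('a) ^ n - a0, -1:] * g" by (simp add: norm_form_def g_def)
  also have "a0 ^ CARD('a) ^ n = a0" using frobenius_period[OF f(1,2)] f(3) by simp
  finally have eq: "norm_form a0 n = pCons 0 (- g)" by simp
  then show "coeff (norm_form a0 n) 0 = 0" by simp
  have "poly g 0 \<noteq> 0"
  proof -
    have "a0 ^ CARD('a) ^ (n - r) \<noteq> a0" if "r \<in> {1..<n}" for r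
    proof
      assume "a0 ^ CARD('a) ^ (n - r) = a0"
      then have "degree f \<le> n - r" using that by (intro frobenius_period_ge[OF f(1,2)]) auto
      moreover have "1 \<le> r" "r < n" using that by auto
      ultimately show False using f(3) by linarith
    qed
    then show ?thesis by (simp add: g_def poly_prod)
  qed
  then show "coeff (norm_form a0 n) 1 \<noteq> 0" by (simp add: eq poly_0_coeff_0)
qed

text \<open>At index \<open>k * n + r\<close>, \<open>a0\<close> is itself the
  \<open>q ^ (k * n + r)\<close>-th power of \<open>a0 ^ q ^ (n - r)\<close>, so additivity pulls
  this exponent out of the difference. What remains, \<open>a0 ^ q ^ (n - r) - a\<close>, does not
  depend on \<open>k\<close>.\<close>

lemma prod_conjugates_eq_norm_form:
  assumes a0: "a0 ^ CARD('a) ^ n = a0" and n: "n > 0"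
  shows "(\<Prod>i<n * m. a0 - a ^ CARD('a) ^ i) = poly (norm_form a0 n) (a - a0) ^ (\<Sum>k<m. (CARD('a) ^ n) ^ k)"
proof -
  define b where "b r = a0 ^ CARD('a) ^ (n - r) - a" for r
  have diff: "x ^ CARD('a) ^ i - y ^ CARD('a) ^ i = (x - y) ^ CARD('a) ^ i" for x y :: 'k and i
    using frobenius_add[of "x - y" y i] by simp
  have factor: "a0 - a ^ CARD('a) ^ (k * n + r) = (b r ^ CARD('a) ^ r) ^ (CARD('a) ^ n) ^ k" if "r < n" for k r
  proof -
    have "n - r + (r + n * k) = n * (k + 1)" using that by (simp add: algebra_simps)
    then have "(a0 ^ CARD('a) ^ (n - r)) ^ CARD('a) ^ (r + n * k) = a0"
      unfolding frobenius_comp by (simp only: frobenius_period_mult[OF a0])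
    then have "a0 - a ^ CARD('a) ^ (r + n * k) = b r ^ CARD('a) ^ (r + n * k)"
      unfolding b_def by (simp flip: diff)
    also have "\<dots> = (b r ^ CARD('a) ^ r) ^ (CARD('a) ^ n) ^ k"
      by (simp add: power_add flip: power_mult)
    finally show ?thesis by (simp add: add.commute mult.commute)
  qed
  have "(\<Prod>i<n * m. a0 - a ^ CARD('a) ^ i) = (\<Prod>k<m. \<Prod>i\<in>{k * n..<k * n + n}. a0 - a ^ CARD('a) ^ i)"
    by (simp add: prod.nat_group mult.commute)
  also have "\<dots> = (\<Prod>k<m. \<Prod>r<n. (b r ^ CARD('a) ^ r) ^ (CARD('a) ^ n) ^ k)"
  proof (rule prod.cong[OF refl])
    fix k
    have "(\<Prod>i\<in>{k * n..<k * n + n}. a0 - a ^ CARD('a) ^ i) = (\<Prod>r<n. a0 - a ^ CARD('a) ^ (k * n + r))"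
      by (rule prod.reindex_bij_witness[of _ "\<lambda>i. k * n + i" "\<lambda>i. i - k * n"]) auto
    then show "(\<Prod>i\<in>{k * n..<k * n + n}. a0 - a ^ CARD('a) ^ i) = (\<Prod>r<n. (b r ^ CARD('a) ^ r) ^ (CARD('a) ^ n) ^ k)"
      by (simp add: factor)
  qed
  also have "\<dots> = (\<Prod>k<m. (\<Prod>r<n. b r ^ CARD('a) ^ r) ^ (CARD('a) ^ n) ^ k)"
    by (simp add: prod_power_distrib)
  also have "\<dots> = (\<Prod>r<n. b r ^ CARD('a) ^ r) ^ (\<Sum>k<m. (CARD('a) ^ n) ^ k)"
    by (simp add: power_sum)
  also have "(\<Prod>r<n. b r ^ CARD('a) ^ r) = poly (norm_form a0 n) (a - a0)"
    by (simp add: norm_form_def poly_prod b_def)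
  finally show ?thesis .
qed

end

text \<open>Each root \<open>a\<close> of such a \<open>p\<close> gives a point
  \<open>a - a0\<close> counted in \<open>stepanov_bound\<close>, with the norm form as
  \<open>h\<close>. The degree \<open>2 * n * s\<close> makes the size of the field the square of
  \<open>P\<close>, with \<open>l\<close> dividing \<open>P - 1\<close>.\<close>

lemma sum_degree_prime_powers_fibre_le:
  fixes hom :: "'a::{field,finite} \<Rightarrow> 'k::alg_closed_field"
  assumes hom: "finite_field_hom hom"
    and f: "irreducible f" "finite_field_hom.eval hom f a0 = 0" "degree f = n"
    and l: "l \<ge> 2" "l dvd CARD('a) ^ n - 1"
    and E: "E = (\<Sum>r<n. CARD('a) ^ r)" and P: "P = CARD('a) ^ (n * s)" "P \<ge> E + 2"
    and U: "U \<subseteq> prime_powers (2 * n * s)"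
    and z: "z \<noteq> 0" "\<And>p e. (p, e) \<in> U \<Longrightarrow> finite_field_hom.eval hom (p ^ e) a0 ^ ((CARD('a) ^ n - 1) div l) = z"
  shows "(\<Sum>(p, e)\<in>U. degree p) \<le> (P - 1) div l * P + (2 * E + 1) * P"
proof -
  interpret finite_field_hom hom by (rule hom)
  define h where "h = norm_form a0 n"
  define c where "c = (P - 1) div l"
  define G where "G = (\<Sum>k<2 * s. (CARD('a) ^ n) ^ k)"
  have n: "n > 0" using irreducible_degree_pos f by blast
  have q1: "1 \<le> CARD('a) ^ n" by simp
  have a0: "a0 ^ CARD('a) ^ n = a0" using frobenius_period[OF f(1,2)] f(3) by simp
  have Ppow: "P = (CARD('a) ^ n) ^ s" by (simp add: P power_mult)
  have "CARD('a) ^ n - 1 dvd P - 1"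
    unfolding Ppow using sum_powers_nat[OF q1, of s] by (metis dvd_triv_right)
  then have lP: "l * c = P - 1" using l by (simp add: c_def dvd_trans)
  have P2: "P\<^sup>2 = CARD('a) ^ (2 * n * s)" by (simp add: P flip: power_mult) (simp add: ac_simps)
  obtain t where t: "CARD('a) ^ n - 1 = l * t" using l(2) by (rule dvdE)
  then have t': "(CARD('a) ^ n - 1) div l = t" using l(1) by simp
  \<comment> \<open>The value at \<open>a0\<close> will be \<open>poly h (a - a0) ^ G\<close>; its
    \<open>((q ^ n - 1) div l)\<close>-th power has to match the exponent in
    \<open>stepanov_bound\<close>. Both exponents are \<open>(P\<^sup>2 - 1) / l\<close>.\<close>
  have "l * (c * (P + 1)) = (P - 1) * (P + 1)" by (simp only: lP mult.assoc[symmetric])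
  also have "\<dots> = P\<^sup>2 - 1" by (cases P) (simp_all add: power2_eq_square)
  also have "P\<^sup>2 = (CARD('a) ^ n) ^ (2 * s)"
    unfolding Ppow by (subst mult.commute) (rule power_mult[symmetric])
  also have "\<dots> - 1 = G * (CARD('a) ^ n - 1)"
    unfolding G_def by (rule sum_powers_nat[OF q1, symmetric])
  also have "\<dots> = l * (G * t)" unfolding t by (rule mult.left_commute)
  finally have G: "c * (P + 1) = G * ((CARD('a) ^ n - 1) div l)" using l(1) unfolding t' by simp
  have add: "(x + y) ^ P = x ^ P + y ^ P" for x y :: 'k
    unfolding P by (rule frobenius_add)
  define S where "S = {x. x ^ P\<^sup>2 = x \<and> poly h x ^ (c * (P + 1)) = z}"
  have h: "coeff h 0 = 0" "coeff h 1 \<noteq> 0" "degree h \<le> E"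
    unfolding h_def E by (rule norm_form_simple_root[OF f] degree_norm_form)+
  have S: "finite S" "card S \<le> c * P + (2 * E + 1) * P"
    unfolding S_def by (rule stepanov_bound[OF add P(2) lP l(1) h z(1)])+
  have "(\<Sum>(p, e)\<in>U. degree p) \<le> card ((\<lambda>x. x + a0) ` S)"
  proof (rule sum_degree_prime_powers_le[OF hom U])
    fix p e a assume pe: "(p, e) \<in> U" "a ^ CARD('a) ^ (2 * n * s) = a"
      and ev: "\<And>x. eval (p ^ e) x = (\<Prod>i<2 * n * s. x - a ^ CARD('a) ^ i)"
    have "a0 ^ P\<^sup>2 = a0"
      using frobenius_period_mult[OF a0, of "2 * s"] by (simp add: P2 ac_simps)
    moreover have "(a - a0) ^ P\<^sup>2 + a0 ^ P\<^sup>2 = a ^ P\<^sup>2"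
      unfolding P2 by (simp flip: frobenius_add)
    ultimately have 1: "(a - a0) ^ P\<^sup>2 = a - a0" using pe(2) by (simp add: P2 algebra_simps)
    have idx: "2 * n * s = n * (2 * s)" by simp
    have "eval (p ^ e) a0 = poly h (a - a0) ^ G"
      unfolding ev idx G_def h_def by (rule prod_conjugates_eq_norm_form[OF a0 n])
    then have "poly h (a - a0) ^ (c * (P + 1)) = z"
      using z(2)[OF pe(1)] by (simp only: G power_mult)
    with 1 have "a - a0 \<in> S" by (simp add: S_def)
    then show "a \<in> (\<lambda>x. x + a0) ` S" by (intro image_eqI[of _ _ "a - a0"]) auto
  qed (use S in simp)
  also have "\<dots> \<le> card S" using S(1) by (rule card_image_le)
  also note S(2)
  finally show ?thesis by (simp add: c_def)
qed

text \<open>If \<open>p ^ e\<close> vanishes at \<open>a0\<close>, every root \<open>a\<close> of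
  \<open>p\<close> makes \<open>a - a0\<close> a root of the norm form, whose degree is bounded
  independently of \<open>m\<close>.\<close>

lemma sum_degree_prime_powers_vanishing_le:
  fixes hom :: "'a::{field,finite} \<Rightarrow> 'k::alg_closed_field"
  assumes hom: "finite_field_hom hom"
    and f: "irreducible f" "finite_field_hom.eval hom f a0 = 0" "degree f = n"
    and U: "U \<subseteq> prime_powers (n * m)"
    and z: "\<And>p e. (p, e) \<in> U \<Longrightarrow> finite_field_hom.eval hom (p ^ e) a0 = 0"
  shows "(\<Sum>(p, e)\<in>U. degree p) \<le> (\<Sum>r<n. CARD('a) ^ r)"
proof -
  interpret finite_field_hom hom by (rule hom)
  define h where "h = norm_form a0 n"
  have n: "n > 0" using irreducible_degree_pos f by blast
  have a0: "a0 ^ CARD('a) ^ n = a0" using frobenius_period[OF f(1,2)] f(3) by simp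
  have "h \<noteq> 0" using norm_form_simple_root[OF f] by (auto simp: h_def)
  then have S: "finite {x. poly h x = 0}" "card {x. poly h x = 0} \<le> degree h"
    by (simp_all add: poly_roots_finite card_poly_roots_bound)
  have "(\<Sum>(p, e)\<in>U. degree p) \<le> card ((\<lambda>x. x + a0) ` {x. poly h x = 0})"
  proof (rule sum_degree_prime_powers_le[OF hom U])
    fix p e a assume pe: "(p, e) \<in> U"
      and ev: "\<And>x. eval (p ^ e) x = (\<Prod>i<n * m. x - a ^ CARD('a) ^ i)"
    have "poly h (a - a0) ^ (\<Sum>k<m. (CARD('a) ^ n) ^ k) = eval (p ^ e) a0"
      unfolding h_def ev by (rule prod_conjugates_eq_norm_form[OF a0 n, symmetric])
    then have "poly h (a - a0) ^ (\<Sum>k<m. (CARD('a) ^ n) ^ k) = 0"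
      by (simp only: z[OF pe])
    then have "poly h (a - a0) = 0" by simp
    then show "a \<in> (\<lambda>x. x + a0) ` {x. poly h x = 0}" by (intro image_eqI[of _ _ "a - a0"]) auto
  qed (use S in simp)
  also have "\<dots> \<le> card {x. poly h x = 0}" using S(1) by (rule card_image_le)
  also have "\<dots> \<le> (\<Sum>r<n. CARD('a) ^ r)" using S(2) degree_norm_form[of a0 n] by (simp add: h_def)
  finally show ?thesis .
qed

section \<open>Generators of the multiplicative group and power characters\<close>

lemma finite_field_generator:
  "\<exists>\<gamma> :: 'b::{field,finite}. \<gamma> \<noteq> 0 \<and> (\<forall>b. b \<noteq> 0 \<longrightarrow> (\<exists>i. b = \<gamma> ^ i))"
proof -
  let ?R = "ring_of_type_algebra :: 'b ring"
  interpret R: field ?R by (rule field_from_type_algebra)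
  have carrier: "carrier (mult_of ?R) = UNIV - {0}"
    by (auto simp: ring_of_type_algebra_def)
  have pow: "x [^]\<^bsub>?R\<^esub> i = x ^ i" for x :: 'b and i :: nat
    by (induction i) (simp_all add: ring_of_type_algebra_def nat_pow_def)
  obtain \<gamma> where "\<gamma> \<in> carrier (mult_of ?R)" "carrier (mult_of ?R) = {\<gamma> [^]\<^bsub>?R\<^esub> i |i::nat. i \<in> UNIV}"
    using R.finite_field_mult_group_has_gen by auto
  then show ?thesis unfolding carrier pow by (intro exI[of _ \<gamma>]) blast
qed

text \<open>If \<open>k\<close> left a nonzero remainder \<open>r\<close> modulo
  \<open>CARD('b) - 1\<close>, then \<open>r\<close> powers of \<open>\<gamma>\<close> would already
  exhaust the nonzero elements, which are more numerous.\<close>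

lemma generator_power_eq_1_imp_dvd:
  fixes \<gamma> :: "'b::{field,finite}"
  assumes "\<gamma> \<noteq> 0" and gen: "\<And>b. b \<noteq> 0 \<Longrightarrow> \<exists>i. b = \<gamma> ^ i" and "\<gamma> ^ k = 1"
  shows "CARD('b) - 1 dvd k"
proof -
  define M where "M = CARD('b) - 1"
  have "\<gamma> * \<gamma> ^ M = \<gamma>"
    using finite_field_power_card[of \<gamma>] two_le_CARD_field[where 'a='b] by (simp add: M_def flip: power_Suc)
  then have M: "\<gamma> ^ M = 1" using assms(1) by simp
  have "M > 0" using two_le_CARD_field[where 'a='b] by (simp add: M_def)
  define r where "r = k mod M"
  have "\<gamma> ^ k = \<gamma> ^ (M * (k div M) + r)" by (simp add: r_def)
  also have "\<dots> = \<gamma> ^ r" by (simp add: power_add power_mult M)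
  finally have r: "\<gamma> ^ r = 1" using assms(3) by simp
  have "r = 0"
  proof (rule ccontr)
    assume "r \<noteq> 0"
    have "UNIV - {0} \<subseteq> (\<lambda>i. \<gamma> ^ i) ` {..<r}"
    proof
      fix b :: 'b assume "b \<in> UNIV - {0}"
      then obtain i where "b = \<gamma> ^ (r * (i div r) + i mod r)" using gen by auto
      then have "b = \<gamma> ^ (i mod r)" by (simp only: power_add power_mult r power_one mult_1_left)
      then show "b \<in> (\<lambda>i. \<gamma> ^ i) ` {..<r}" using \<open>r \<noteq> 0\<close> by simp
    qed
    then have "card (UNIV - {0 :: 'b}) \<le> card ((\<lambda>i. \<gamma> ^ i) ` {..<r})" by (intro card_mono) auto
    also have "\<dots> \<le> r" using card_image_le[of "{..<r}" "\<lambda>i. \<gamma> ^ i"] by simp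
    finally have "M \<le> r" by (simp add: M_def card_Diff_singleton)
    moreover have "r < M" using \<open>M > 0\<close> by (simp add: r_def)
    ultimately show False by simp
  qed
  then show ?thesis by (auto simp: r_def M_def)
qed

text \<open>The value of \<open>discrete_log\<close> is only meaningful modulo \<open>CARD('b) - 1\<close>.\<close>

definition discrete_log :: "'b::{field,finite} \<Rightarrow> 'b \<Rightarrow> nat" where
  "discrete_log \<gamma> b = (SOME i. b = \<gamma> ^ i)"

definition power_character :: "'b::{field,finite} \<Rightarrow> complex \<Rightarrow> 'b \<Rightarrow> complex" where
  "power_character \<gamma> \<omega> b = (if b = 0 then 0 else \<omega> ^ discrete_log \<gamma> b)"

locale generator =
  fixes \<gamma> :: "'b::{field,finite}" and l :: nat and \<omega> :: complex
  assumes nonzero: "\<gamma> \<noteq> 0" and gen: "\<And>b. b \<noteq> 0 \<Longrightarrow> \<exists>i. b = \<gamma> ^ i"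
    and l: "l \<ge> 2" "l dvd CARD('b) - 1"
    and \<omega>: "\<omega> ^ l = 1" "\<omega> \<noteq> 1"
begin

abbreviation "\<chi> \<equiv> power_character \<gamma> \<omega>"

lemma power_discrete_log:
  assumes "b \<noteq> 0"
  shows "\<gamma> ^ discrete_log \<gamma> b = b"
proof -
  obtain i where i: "b = \<gamma> ^ i" using gen[OF assms] by (rule exE)
  have "b = \<gamma> ^ discrete_log \<gamma> b" unfolding discrete_log_def by (rule someI[where P = "\<lambda>i. b = \<gamma> ^ i"]) (rule i)
  then show ?thesis by (rule sym)
qed

lemma power_card_minus_1: "\<gamma> ^ (CARD('b) - 1) = 1"
proof -
  have "\<gamma> * \<gamma> ^ (CARD('b) - 1) = \<gamma>"
    using finite_field_power_card[of \<gamma>] two_le_CARD_field[where 'a='b] by (simp flip: power_Suc)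
  then show ?thesis using nonzero by simp
qed

lemma omega_power_mod: "\<omega> ^ i = \<omega> ^ (i mod l)"
proof -
  have "\<omega> ^ i = \<omega> ^ (l * (i div l) + i mod l)" by simp
  also have "\<dots> = \<omega> ^ (i mod l)" by (simp only: power_add power_mult \<omega> power_one mult_1_left)
  finally show ?thesis .
qed

text \<open>Well-definedness of the character: exponents of equal powers of \<open>\<gamma>\<close>
  differ by a multiple of \<open>CARD('b) - 1\<close>, hence of \<open>l\<close>.\<close>

lemma omega_power_eq:
  assumes "\<gamma> ^ i = \<gamma> ^ k"
  shows "\<omega> ^ i = \<omega> ^ k"
proof -
  have "\<omega> ^ i = \<omega> ^ k" if "i \<le> k" "\<gamma> ^ i = \<gamma> ^ k" for i k
  proof -
    have "\<gamma> ^ i * \<gamma> ^ (k - i) = \<gamma> ^ k" using that(1) by (simp flip: power_add)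
    then have "\<gamma> ^ (k - i) = 1" using nonzero that(2) by simp
    then have "l dvd k - i" using dvd_trans[OF l(2) generator_power_eq_1_imp_dvd[OF nonzero gen]] by blast
    then obtain t where "k - i = l * t" by (rule dvdE)
    then have "k = i + l * t" using that(1) by simp
    then show ?thesis by (simp add: power_add power_mult \<omega>)
  qed
  note le = this
  show ?thesis
  proof (cases "i \<le> k")
    case True
    then show ?thesis using assms by (rule le)
  next
    case False
    then have "k \<le> i" by simp
    then have "\<omega> ^ k = \<omega> ^ i" using assms[symmetric] by (rule le)
    then show ?thesis by (rule sym)
  qed
qed

lemma chi_0 [simp]: "\<chi> 0 = 0"
  by (simp add: power_character_def)

lemma chi_power: "\<chi> (\<gamma> ^ i) = \<omega> ^ i"
proof -
  have "\<gamma> ^ discrete_log \<gamma> (\<gamma> ^ i) = \<gamma> ^ i" by (rule power_discrete_log) (simp add: nonzero)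
  then have "\<omega> ^ discrete_log \<gamma> (\<gamma> ^ i) = \<omega> ^ i" by (rule omega_power_eq)
  then show ?thesis by (simp add: power_character_def nonzero)
qed

lemma chi_1 [simp]: "\<chi> 1 = 1"
  using chi_power[of 0] by simp

lemma chi_mult: "\<chi> (a * b) = \<chi> a * \<chi> b"
proof (cases "a = 0 \<or> b = 0")
  case False
  then obtain i k where "a = \<gamma> ^ i" "b = \<gamma> ^ k" using gen[of a] gen[of b] by auto
  then show ?thesis by (simp add: chi_power flip: power_add)
qed auto

text \<open>Multiplication by \<open>\<gamma>\<close> permutes the field and multiplies the sum by
  \<open>\<omega> \<noteq> 1\<close>.\<close>

lemma sum_chi: "(\<Sum>b\<in>UNIV. \<chi> b) = 0"
proof -
  have "(\<Sum>b\<in>UNIV. \<chi> b) = (\<Sum>b\<in>UNIV. \<chi> (\<gamma> * b))"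
    by (rule sum.reindex_bij_witness[of _ "\<lambda>b. \<gamma> * b" "\<lambda>b. b / \<gamma>"]) (use nonzero in auto)
  also have "\<dots> = \<omega> * (\<Sum>b\<in>UNIV. \<chi> b)"
    using chi_power[of 1] by (simp add: chi_mult sum_distrib_left)
  finally have "(1 - \<omega>) * (\<Sum>b\<in>UNIV. \<chi> b) = 0" by (simp add: algebra_simps)
  then show ?thesis using \<omega> by simp
qed

lemma norm_omega: "norm \<omega> = 1"
  using power_eq_1_iff[OF \<omega>(1)] l by auto

lemma sum_omega: "(\<Sum>j<l. \<omega> ^ j) = 0"
  using \<omega> by (simp add: sum_gp_strict)

end

text \<open>Stepanov's method bounds each fibre from above only. The lower bound comes from the
  total: \<open>T j\<close> is the total minus the other values, each at most
  \<open>a + b\<close>.\<close>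

lemma fibre_deviation:
  fixes T :: "nat \<Rightarrow> real"
  assumes l: "l \<ge> 1" and up: "\<And>j. j < l \<Longrightarrow> T j \<le> a + b" and sum: "(\<Sum>j<l. T j) \<ge> real l * a - e"
    and "b \<ge> 0" "e \<ge> 0" and j: "j < l"
  shows "\<bar>T j - a\<bar> \<le> real l * b + e"
proof -
  have "(\<Sum>i\<in>{..<l} - {j}. T i) \<le> (\<Sum>i\<in>{..<l} - {j}. a + b)"
    using up by (intro sum_mono) auto
  also have "\<dots> = (real l - 1) * (a + b)" using j by (simp add: of_nat_diff)
  finally have "(\<Sum>i<l. T i) \<le> T j + (real l - 1) * (a + b)"
    using j by (simp add: sum.remove[of "{..<l}" j])
  then have "T j - a \<ge> - (real l * b) + b - e" using sum by (simp add: algebra_simps)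
  moreover have "T j - a \<le> 1 * b" using up[OF j] by simp
  moreover have "1 * b \<le> real l * b" using l assms(4) by (intro mult_right_mono) auto
  ultimately show ?thesis using assms(4,5) unfolding abs_le_iff by linarith
qed

section \<open>The square root bound and connectedness\<close>

locale generator_extension = generator \<gamma> l \<omega> + finite_field_hom \<iota>
  for \<gamma> :: "'b::{field,finite}" and l \<omega> and \<iota> :: "'a::{field,finite} \<Rightarrow> 'b" +
  fixes f :: "'a poly" and \<alpha> :: 'b and n :: nat
  assumes f: "irreducible f" "eval f \<alpha> = 0" "degree f = n"
    and card_ext: "CARD('b) = CARD('a) ^ n"
begin

text \<open>The algebraic closure supplies roots for the polynomials \<open>p\<close> of all degrees
  and the \<open>P\<close>-th roots in \<open>stepanov_bound\<close>.\<close>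

definition embed :: "'a \<Rightarrow> 'b alg_closure" where "embed a = to_ac (\<iota> a)"

text \<open>A Dirichlet character modulo \<open>f\<close>.\<close>

definition \<phi> :: "'a poly \<Rightarrow> complex" where "\<phi> g = \<chi> (eval g \<alpha>)"

lemma embed_hom: "finite_field_hom embed"
  by unfold_locales (simp_all add: embed_def hom_distribs)

lemma eval_embed: "finite_field_hom.eval embed g (to_ac x) = to_ac (eval g x)"
proof -
  interpret E: finite_field_hom embed by (rule embed_hom)
  show ?thesis by (induction g) (simp_all, simp add: embed_def)
qed

lemma f_embed: "finite_field_hom.eval embed f (to_ac \<alpha>) = 0"
  by (simp add: eval_embed f)

lemma phi_mult: "\<phi> (g * h) = \<phi> g * \<phi> h"
  by (simp add: \<phi>_def chi_mult)

lemma char_sum_phi_0: "char_sum \<phi> 0 = 1"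
proof -
  have "monic_polys 0 = {1 :: 'a poly}"
    by (auto simp: monic_polys_def elim!: degree_eq_zeroE)
  then show ?thesis by (simp add: char_sum_def \<phi>_def)
qed

lemma char_sum_phi_eq_0:
  assumes "k \<ge> n"
  shows "char_sum \<phi> k = 0"
proof -
  have inj: "inj_on (\<lambda>g. eval g \<alpha>) (polys_below n)"
    using eval_inj_on_polys_below[OF f(1,2)] f(3) by simp
  then have "card ((\<lambda>g. eval g \<alpha>) ` polys_below n) = CARD('b)"
    by (simp add: card_image card_polys_below card_ext)
  then have "(\<lambda>g. eval g \<alpha>) ` polys_below n = UNIV"
    by (intro card_subset_eq) auto
  with inj have "bij_betw (\<lambda>g. eval g \<alpha>) (polys_below n) UNIV" by (simp add: bij_betw_def)
  then show ?thesis
    unfolding \<phi>_def using assms sum_chi by (intro char_sum_eq_0) auto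
qed

text \<open>The residue of the discrete logarithm modulo \<open>l\<close> fixes both the value
  \<open>\<omega> ^ j\<close> of \<open>\<phi>\<close> and the \<open>((q ^ n - 1) div l)\<close>-th
  power that Stepanov's method can count.\<close>

definition fibre :: "nat \<Rightarrow> nat \<Rightarrow> ('a poly \<times> nat) set" where
  "fibre N j = {x \<in> {x \<in> prime_powers N. eval (fst x ^ snd x) \<alpha> \<noteq> 0}.
    discrete_log \<gamma> (eval (fst x ^ snd x) \<alpha>) mod l = j}"

lemma sum_degree_fibre_le:
  assumes E: "E = (\<Sum>r<n. CARD('a) ^ r)" and P: "P = CARD('a) ^ (n * s)" "P \<ge> E + 2"
  shows "(\<Sum>(p, e)\<in>fibre (2 * n * s) j. degree p) \<le> (P - 1) div l * P + (2 * E + 1) * P"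
proof (rule sum_degree_prime_powers_fibre_le[OF embed_hom f(1) f_embed f(3) l(1) _ E P])
  define m where "m = (CARD('a) ^ n - 1) div l"
  show dvd: "l dvd CARD('a) ^ n - 1" using l(2) card_ext by simp
  have lm: "l * m = CARD('b) - 1" using dvd by (simp add: m_def card_ext)
  show "fibre (2 * n * s) j \<subseteq> prime_powers (2 * n * s)" by (auto simp: fibre_def)
  show "to_ac (\<gamma> ^ (j * m)) \<noteq> 0" using nonzero by simp
  fix p e assume pe: "(p, e) \<in> fibre (2 * n * s) j"
  define i where "i = discrete_log \<gamma> (eval (p ^ e) \<alpha>)"
  have i: "eval (p ^ e) \<alpha> = \<gamma> ^ i" "i mod l = j"
    using pe power_discrete_log by (auto simp: fibre_def i_def)
  \<comment> \<open>Since \<open>l * m = CARD('b) - 1\<close> is a period of the powers of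
    \<open>\<gamma>\<close>, only \<open>i mod l\<close> matters.\<close>
  have "i * m = (CARD('b) - 1) * (i div l) + j * m"
  proof -
    have "i * m = (l * (i div l) + i mod l) * m" by simp
    also have "\<dots> = (l * m) * (i div l) + j * m" by (simp add: i(2) algebra_simps)
    finally show ?thesis by (simp only: lm)
  qed
  then have "\<gamma> ^ (i * m) = \<gamma> ^ (j * m)"
    by (simp only: power_add power_mult[of _ "CARD('b) - 1"] power_card_minus_1 power_one mult_1_left)
  then show "finite_field_hom.eval embed (p ^ e) (to_ac \<alpha>) ^ ((CARD('a) ^ n - 1) div l) = to_ac (\<gamma> ^ (j * m))"
    unfolding eval_embed i(1) by (simp add: m_def power_mult flip: to_ac_power)
qed

text \<open>Each fibre has weight at most \<open>P\<^sup>2 / l\<close> plus a multiple of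
  \<open>P\<close>, and the total misses \<open>P\<^sup>2\<close> by at most \<open>E\<close>, so
  every fibre is close to the average \<open>a\<close>. The average itself cancels because the
  powers of \<open>\<omega>\<close> sum to \<open>0\<close>.\<close>

lemma prime_power_sum_weak_bound:
  assumes E: "E = (\<Sum>r<n. CARD('a) ^ r)" and P: "P = CARD('a) ^ (n * s)" "P \<ge> E + 2"
  shows "norm (prime_power_sum \<phi> (2 * n * s)) \<le> real l * (real l * real (2 * E + 1) + real E) * real P"
proof -
  define N where "N = 2 * n * s"
  define T where "T j = real (\<Sum>(p, e)\<in>fibre N j. degree p)" for j
  define a where "a = (real P)\<^sup>2 / real l"
  define b where "b = real ((2 * E + 1) * P)"
  define A where "A = {x \<in> prime_powers N. eval (fst x ^ snd x) \<alpha> \<noteq> 0}"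
  define Z where "Z = {x \<in> prime_powers N. eval (fst x ^ snd x) \<alpha> = 0}"
  have fin: "finite A" "finite Z"
    by (rule finite_subset[OF _ finite_prime_powers[of N]], force simp: A_def Z_def)+
  have split: "prime_powers N = A \<union> Z" "A \<inter> Z = {}" by (auto simp: A_def Z_def)
  have fibre: "fibre N j = {x \<in> A. discrete_log \<gamma> (eval (fst x ^ snd x) \<alpha>) mod l = j}" for j
    by (auto simp: fibre_def A_def)
  have group: "(\<Sum>j<l. \<Sum>x\<in>fibre N j. h x) = (\<Sum>x\<in>A. h x)" for h :: "'a poly \<times> nat \<Rightarrow> 'c::comm_monoid_add"
    unfolding fibre using fin l by (intro sum.group) auto
  have P0: "P > 0" using P by simp
  have n: "n > 0" using irreducible_degree_pos f by blast
  have s: "s > 0" using P by (cases s) auto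
  have up: "T j \<le> a + b" for j
  proof -
    have "T j \<le> real ((P - 1) div l * P + (2 * E + 1) * P)"
      unfolding T_def N_def by (rule of_nat_mono) (rule sum_degree_fibre_le[OF E P])
    also have "\<dots> = real ((P - 1) div l) * real P + b" by (simp add: b_def)
    also have "real ((P - 1) div l) \<le> real P / real l"
      by (rule order_trans[OF of_nat_div_le_of_nat]) (simp add: divide_right_mono)
    finally show ?thesis by (simp add: a_def power2_eq_square mult_right_mono)
  qed
  have "(\<Sum>x\<in>(prime_powers N :: ('a poly \<times> nat) set). degree (fst x)) = CARD('a) ^ N"
    using sum_degree_prime_powers[of N, where 'a='a] n s by (simp add: N_def case_prod_unfold)
  also have "CARD('a) ^ N = P\<^sup>2" by (simp add: N_def P flip: power_mult) (simp add: ac_simps)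
  also have "(\<Sum>x\<in>(prime_powers N :: ('a poly \<times> nat) set). degree (fst x)) = (\<Sum>x\<in>A. degree (fst x)) + (\<Sum>x\<in>Z. degree (fst x))"
    unfolding split(1) using fin split(2) by (intro sum.union_disjoint) auto
  finally have tot: "(\<Sum>x\<in>A. degree (fst x)) + (\<Sum>x\<in>Z. degree (fst x)) = P\<^sup>2" .
  have "(\<Sum>(p, e)\<in>Z. degree p) \<le> (\<Sum>r<n. CARD('a) ^ r)"
  proof (rule sum_degree_prime_powers_vanishing_le[OF embed_hom f(1) f_embed f(3)])
    show "Z \<subseteq> prime_powers (n * (2 * s))" by (auto simp: Z_def N_def ac_simps)
    show "finite_field_hom.eval embed (p ^ e) (to_ac \<alpha>) = 0" if "(p, e) \<in> Z" for p e
      using that unfolding eval_embed by (simp add: Z_def)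
  qed
  then have "P\<^sup>2 \<le> (\<Sum>x\<in>A. degree (fst x)) + E" using tot by (simp add: E case_prod_unfold)
  then have "(real P)\<^sup>2 \<le> (\<Sum>j<l. T j) + real E"
    by (simp add: T_def case_prod_unfold group flip: of_nat_sum of_nat_add of_nat_power)
  then have low: "(\<Sum>j<l. T j) \<ge> real l * a - real E" using l by (simp add: a_def)
  have dev: "\<bar>T j - a\<bar> \<le> real l * b + real E" if "j < l" for j
    using l up low that by (intro fibre_deviation) (auto simp: b_def)
  have vanish: "\<phi> (fst x ^ snd x) = 0" if "x \<in> prime_powers N - A" for x
  proof -
    have "eval (fst x ^ snd x) \<alpha> = 0" using that unfolding A_def by blast
    then show ?thesis unfolding \<phi>_def by (simp only: chi_0)
  qed
  have "prime_power_sum \<phi> N = (\<Sum>x\<in>prime_powers N. of_nat (degree (fst x)) * \<phi> (fst x ^ snd x))"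
    by (simp add: prime_power_sum_def case_prod_unfold)
  also have "\<dots> = (\<Sum>x\<in>A. of_nat (degree (fst x)) * \<phi> (fst x ^ snd x))"
    using vanish split(1) by (intro sum.mono_neutral_right finite_prime_powers) auto
  also have "\<dots> = (\<Sum>j<l. \<Sum>x\<in>fibre N j. of_nat (degree (fst x)) * \<phi> (fst x ^ snd x))"
    by (rule group[symmetric])
  also have "\<dots> = (\<Sum>j<l. of_real (T j) * \<omega> ^ j)"
  proof (intro sum.cong refl)
    fix j
    have "\<phi> (fst x ^ snd x) = \<omega> ^ j" if "x \<in> fibre N j" for x
    proof -
      have x: "eval (fst x ^ snd x) \<alpha> \<noteq> 0" "discrete_log \<gamma> (eval (fst x ^ snd x) \<alpha>) mod l = j"
        using that unfolding fibre_def by blast+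
      have "\<phi> (fst x ^ snd x) = \<omega> ^ discrete_log \<gamma> (eval (fst x ^ snd x) \<alpha>)"
        unfolding \<phi>_def power_character_def by (rule if_not_P) (rule x(1))
      also have "\<dots> = \<omega> ^ (discrete_log \<gamma> (eval (fst x ^ snd x) \<alpha>) mod l)" by (rule omega_power_mod)
      finally show ?thesis by (simp only: x(2))
    qed
    then show "(\<Sum>x\<in>fibre N j. of_nat (degree (fst x)) * \<phi> (fst x ^ snd x)) = of_real (T j) * \<omega> ^ j"
      by (simp add: T_def case_prod_unfold sum_distrib_right)
  qed
  also have "\<dots> = (\<Sum>j<l. of_real (T j - a) * \<omega> ^ j)"
  proof -
    have "(\<Sum>j<l. of_real a * \<omega> ^ j) = 0" by (simp add: sum_omega flip: sum_distrib_left)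
    then show ?thesis by (simp add: left_diff_distrib sum_subtractf)
  qed
  finally have "norm (prime_power_sum \<phi> N) \<le> (\<Sum>j<l. norm (of_real (T j - a) * \<omega> ^ j))"
    by (simp only: norm_sum)
  also have "\<dots> \<le> (\<Sum>j<l. real l * b + real E)"
    using dev by (intro sum_mono) (simp add: norm_mult norm_power norm_omega flip: of_real_diff)
  also have "\<dots> = real l * (real l * b + real E * 1)" by simp
  also have "\<dots> \<le> real l * (real l * b + real E * real P)"
    using P0 by (intro mult_left_mono add_left_mono) auto
  also have "\<dots> = real l * (real l * real (2 * E + 1) + real E) * real P"
    by (simp add: b_def algebra_simps)
  finally show ?thesis by (simp add: N_def)
qed

lemma prime_power_sum_bound:
  assumes "d \<ge> 1"
  shows "norm (prime_power_sum \<phi> d) \<le> real (n - 1) * sqrt (real CARD('a)) ^ d"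
proof -
  define E where "E = (\<Sum>r<n. CARD('a) ^ r)"
  have n: "n > 0" using irreducible_degree_pos f by blast
  show ?thesis
  proof (rule riemann_hypothesis_from_weak_bound[where c = "char_sum \<phi>" and M = "2 * n" and ?s0.0 = "E + 2"
        and C = "real l * (real l * real (2 * E + 1) + real E)"])
    show "char_sum \<phi> 0 = 1" by (rule char_sum_phi_0)
    show "char_sum \<phi> k = 0" if "k \<ge> n" for k using that by (rule char_sum_phi_eq_0)
    show "of_nat k * char_sum \<phi> k = (\<Sum>N=1..k. prime_power_sum \<phi> N * char_sum \<phi> (k - N))" for k
      by (rule char_sum_recursion) (rule phi_mult)
    \<comment> \<open>\<open>E + 2 \<le> s \<le> 2 ^ s \<le> q ^ (n * s)\<close> gives the condition
      on \<open>P = q ^ (n * s)\<close>. As a power of \<open>sqrt q\<close>, \<open>P\<close> is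
      \<open>(sqrt q ^ (2 * n)) ^ s\<close>, whence \<open>M = 2 * n\<close>.\<close>
    fix s assume s: "s \<ge> E + 2"
    have "s \<le> 2 ^ s" by (simp add: less_imp_le)
    also have "(2::nat) ^ s \<le> CARD('a) ^ s" using two_le_CARD_field by (intro power_mono) auto
    also have "\<dots> \<le> CARD('a) ^ (n * s)" using n by (intro power_increasing) auto
    finally have "E + 2 \<le> CARD('a) ^ (n * s)" using s by simp
    then have "norm (prime_power_sum \<phi> (2 * n * s)) \<le> real l * (real l * real (2 * E + 1) + real E) * real (CARD('a) ^ (n * s))"
      by (intro prime_power_sum_weak_bound E_def refl)
    also have "real (CARD('a) ^ (n * s)) = (sqrt (real CARD('a)) ^ (2 * n)) ^ s"
      by (simp add: power_mult)
    finally show "norm (prime_power_sum \<phi> (2 * n * s))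
      \<le> real l * (real l * real (2 * E + 1) + real E) * (sqrt (real CARD('a)) ^ (2 * n)) ^ s" .
  qed (use n assms in auto)
qed

end

section \<open>From the character bound to generation and connectedness\<close>

lemma prime_power_mem_monic_primary_polys:
  assumes "(p, e) \<in> prime_powers d" and "d \<ge> 1"
  shows "p ^ e \<in> monic_primary_polys d"
proof -
  have p: "irreducible p" "lead_coeff p = 1" "degree p * e = d" using assms(1) by (auto simp: prime_powers_def)
  have "p \<noteq> 0" using p(1) by auto
  then have "degree (p ^ e) = d" using p(3) by (simp add: degree_power_eq mult.commute)
  moreover have "lead_coeff (p ^ e) = 1" using p(2) by (simp only: lead_coeff_power power_one)
  ultimately show ?thesis
    using assms(2) p(1) by (auto simp: monic_primary_polys_def primary_poly_def)
qed

text \<open>For the least positive \<open>l\<close> with \<open>\<gamma> ^ l\<close> in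
  \<open>H\<close>, all elements of \<open>H\<close> are powers of \<open>\<gamma> ^ l\<close>. If
  \<open>l > 1\<close>, the character sending \<open>\<gamma>\<close> to
  \<open>cis (2 * pi / real l)\<close> is \<open>1\<close> on \<open>H\<close>, so
  \<open>prime_power_sum \<phi> d\<close> is the full weight \<open>q ^ d\<close>, against the bound
  \<open>(n - 1) * q ^ (d / 2)\<close>.\<close>

lemma generates_from_character_bound:
  fixes \<iota> :: "'a::{field,finite} \<Rightarrow> 'b::{field,finite}"
  assumes \<iota>: "finite_field_hom \<iota>" and card: "CARD('b) = CARD('a) ^ n"
    and f: "irreducible f" "finite_field_hom.eval \<iota> f \<alpha> = 0" "degree f = n"
    and d: "d \<ge> 1" and n: "real (n - 1) < sqrt (real CARD('a)) ^ d"
    and H: "1 \<in> H" "0 \<notin> H" "\<And>x y. x \<in> H \<Longrightarrow> y \<in> H \<Longrightarrow> x * y \<in> H" "primary_values \<iota> \<alpha> d \<subseteq> H"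
  shows "H = UNIV - {0}"
proof -
  obtain \<gamma> :: 'b where \<gamma>: "\<gamma> \<noteq> 0" "\<And>b. b \<noteq> 0 \<Longrightarrow> \<exists>i. b = \<gamma> ^ i"
    using finite_field_generator by blast
  define M where "M = CARD('b) - 1"
  have M: "M > 0" using two_le_CARD_field[where 'a='b] by (simp add: M_def)
  have "\<gamma> * \<gamma> ^ M = \<gamma>"
    using finite_field_power_card[of \<gamma>] two_le_CARD_field[where 'a='b] by (simp add: M_def flip: power_Suc)
  then have \<gamma>M: "\<gamma> ^ M = 1" using \<gamma>(1) by simp
  define l where "l = (LEAST i. i > 0 \<and> \<gamma> ^ i \<in> H)"
  have ex: "M > 0 \<and> \<gamma> ^ M \<in> H" using M \<gamma>M H(1) by simp
  have l: "l > 0" "\<gamma> ^ l \<in> H" unfolding l_def using LeastI[of "\<lambda>i. i > 0 \<and> \<gamma> ^ i \<in> H", OF ex] by auto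
  have least: "\<not> (k > 0 \<and> \<gamma> ^ k \<in> H)" if "k < l" for k
    using that unfolding l_def by (rule not_less_Least)
  have Hpow: "x ^ k \<in> H" if "x \<in> H" for x k using that H(1,3) by (induction k) auto
  have ldvd: "l dvd i" if "\<gamma> ^ i \<in> H" for i
  proof -
    \<comment> \<open>The assumptions give closure under products, so the power \<open>M - 1\<close>
      stands in for inversion, and \<open>\<gamma> ^ (i mod l)\<close> becomes a product of elements
      of \<open>H\<close>.\<close>
    have "i + l * (M - 1) * (i div l) = i mod l + M * l * (i div l)"
    proof -
      have "i + l * (M - 1) * (i div l) = i mod l + (l * (i div l) + l * (M - 1) * (i div l))" by simp
      also have "l * (i div l) + l * (M - 1) * (i div l) = M * l * (i div l)"
        using M by (cases M) (simp_all add: algebra_simps)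
      finally show ?thesis .
    qed
    then have "\<gamma> ^ i * (\<gamma> ^ l) ^ ((M - 1) * (i div l)) = \<gamma> ^ (i mod l) * (\<gamma> ^ M) ^ (l * (i div l))"
      by (simp add: mult.assoc flip: power_mult power_add)
    then have "\<gamma> ^ (i mod l) \<in> H" using H(3) that Hpow[OF l(2)] by (simp add: \<gamma>M) (metis H(3))
    moreover have "i mod l < l" using l by simp
    ultimately have "i mod l = 0" using least[of "i mod l"] by auto
    then show ?thesis by auto
  qed
  have "l = 1"
  proof (rule ccontr)
    assume "l \<noteq> 1"
    then have l2: "l \<ge> 2" using l by simp
    define \<omega> where "\<omega> = cis (2 * pi / real l)"
    have "\<omega> ^ l = 1" using l2 by (simp add: \<omega>_def DeMoivre)
    moreover have "\<omega> \<noteq> 1"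
    proof
      assume "\<omega> = 1"
      then have "cos (2 * pi / real l) = 1" by (simp add: \<omega>_def complex_eq_iff)
      moreover have "cos (2 * pi / real l) < cos 0"
        using l2 by (intro cos_monotone_0_pi) (auto simp: field_simps)
      ultimately show False by simp
    qed
    ultimately interpret generator_extension \<gamma> l \<omega> \<iota> f \<alpha> n
      using \<gamma> l2 ldvd[of M] ex \<iota> f card
      by (intro generator_extension.intro generator.intro generator_extension_axioms.intro) (auto simp: M_def)
    have "\<phi> (p ^ e) = 1" if "(p, e) \<in> prime_powers d" for p e
    proof -
      have "eval (p ^ e) \<alpha> \<in> H"
        using prime_power_mem_monic_primary_polys[OF that d] H(4)
        by (auto simp: primary_values_def eval_def)
      moreover from this obtain i where "eval (p ^ e) \<alpha> = \<gamma> ^ i" using \<gamma>(2) H(2) by metis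
      ultimately show ?thesis using ldvd[of i] by (auto simp: \<phi>_def chi_power power_mult \<omega> elim!: dvdE)
    qed
    then have "prime_power_sum \<phi> d = of_nat (\<Sum>(p, e)\<in>(prime_powers d :: ('a poly \<times> nat) set). degree p)"
      by (auto simp: prime_power_sum_def case_prod_unfold intro!: sum.cong)
    then have "norm (prime_power_sum \<phi> d) = real (CARD('a) ^ d)"
      unfolding sum_degree_prime_powers[OF d] by (simp only: norm_of_nat)
    also have "\<dots> = sqrt (real CARD('a)) ^ d * sqrt (real CARD('a)) ^ d"
      by (simp flip: power_mult_distrib)
    finally have "sqrt (real CARD('a)) ^ d * sqrt (real CARD('a)) ^ d \<le> real (n - 1) * sqrt (real CARD('a)) ^ d"
      using prime_power_sum_bound[OF d] by simp
    moreover have "sqrt (real CARD('a)) ^ d > 0" by simp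
    ultimately have "sqrt (real CARD('a)) ^ d \<le> real (n - 1)" by (simp only: mult_le_cancel_right_pos)
    with n show False by simp
  qed
  then have "\<gamma> \<in> H" using l by simp
  then have "b \<in> H" if "b \<noteq> 0" for b using \<gamma>(2)[OF that] Hpow by blast
  then show ?thesis using H(2) by auto
qed

theorem theorem8:
  fixes \<iota> :: "'a::{field,finite} \<Rightarrow> 'b::{field,finite}"
    and f :: "'a poly" and \<alpha> :: 'b and q n d :: nat
  assumes "field_hom \<iota>"
    and "CARD('a) = q" and "CARD('b) = q ^ n"
    and "n > 1" and "1 \<le> d" and "d < n"
    and "irreducible f" and "degree f = n"
    and "poly (map_poly \<iota> f) \<alpha> = 0"
    and "real n < real q powr (real d / 2) + 1"
  shows "strongly_connected (with_proj (primary_digraph \<iota> \<alpha> d))"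
proof -
  interpret field_hom \<iota> by (rule assms(1))
  interpret finite_field_hom \<iota> by unfold_locales
  let ?G = "with_proj (primary_digraph \<iota> \<alpha> d)"
  have verts: "pverts (primary_digraph \<iota> \<alpha> d) = UNIV - {0}" by (simp add: primary_digraph_def)
  have arcs: "parcs (primary_digraph \<iota> \<alpha> d) = {(x, y). x \<noteq> 0 \<and> y \<noteq> 0 \<and> y / x \<in> primary_values \<iota> \<alpha> d}"
    by (simp add: primary_digraph_def)
  have f: "eval f \<alpha> = 0" using assms(9) by (simp add: eval_def)
  \<comment> \<open>Quantifying over all starting points makes \<open>H\<close> closed under
    products: a walk from \<open>u\<close> to \<open>u * x\<close> continues to
    \<open>u * x * y\<close>.\<close>
  define H where "H = {b. b \<noteq> 0 \<and> (\<forall>u. u \<noteq> 0 \<longrightarrow> u \<rightarrow>\<^sup>*\<^bsub>?G\<^esub> (u * b))}"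
  have "H = UNIV - {0}"
  proof (rule generates_from_character_bound)
    show "finite_field_hom \<iota>" by unfold_locales
    show "CARD('b) = CARD('a) ^ n" using assms(2,3) by simp
    have q0: "q > 0" using assms(2) by auto
    then have "real q powr (real d / 2) = sqrt (real CARD('a)) ^ d"
      by (simp add: assms(2) powr_half_sqrt[symmetric] powr_powr powr_realpow[symmetric])
    then show "real (n - 1) < sqrt (real CARD('a)) ^ d" using assms(4,10) by (simp add: of_nat_diff)
    show "1 \<in> H" by (auto simp: H_def reachable_def verts)
    show "0 \<notin> H" by (simp add: H_def)
    show "x * y \<in> H" if "x \<in> H" "y \<in> H" for x y
      using that unfolding H_def reachable_def
      by (auto intro: rtrancl_on_trans[of _ "_ * x"] simp flip: mult.assoc)
    show "primary_values \<iota> \<alpha> d \<subseteq> H"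
    proof
      fix b assume b: "b \<in> primary_values \<iota> \<alpha> d"
      then obtain g where g: "b = eval g \<alpha>" "lead_coeff g = 1" "degree g = d"
        by (auto simp: primary_values_def monic_primary_polys_def eval_def)
      have "b \<noteq> 0"
      proof
        assume "b = 0"
        then have "f dvd g" using irreducible_dvd_of_common_root[OF assms(7) f] g(1) by simp
        moreover have "g \<noteq> 0" using g(2) by auto
        ultimately have "n \<le> d" using dvd_imp_degree_le[of f g] assms(8) g(3) by simp
        then show False using assms(6) by simp
      qed
      moreover have "u \<rightarrow>\<^sup>*\<^bsub>?G\<^esub> (u * b)" if "u \<noteq> 0" for u
        unfolding reachable_def
        by (rule rtrancl_on_into_rtrancl_on[of u u]) (use that b \<open>b \<noteq> 0\<close> in \<open>auto simp: verts arcs\<close>)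
      ultimately show "b \<in> H" by (simp add: H_def)
    qed
  qed (use f assms in auto)
  show ?thesis
  proof (rule strongly_connectedI)
    have "1 \<in> UNIV - {0 :: 'b}" by simp
    then show "verts ?G \<noteq> {}" unfolding with_proj_simps verts by blast
    fix u v assume uv: "u \<in> verts ?G" "v \<in> verts ?G"
    then have "v / u \<in> H" unfolding \<open>H = UNIV - {0}\<close> with_proj_simps verts by simp
    then have "u \<rightarrow>\<^sup>*\<^bsub>?G\<^esub> (u * (v / u))" using uv unfolding H_def with_proj_simps verts by blast
    moreover have "u * (v / u) = v" using uv by (simp add: verts)
    ultimately show "u \<rightarrow>\<^sup>*\<^bsub>?G\<^esub> v" by (simp only:)
  qed
qed

end
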